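(* Let $\Gamma$ be a commutative monoid (written additively), let $A$ be a finitely generated $\Gamma$-graded monoid (with identity and absorbing element), let $\mathrm{H}_A$ be the Hall algebra of finite $A$-modules, and let $$\mathcal{J}^{gr}=\operatorname{span}\{\delta_{\overline M} : M \text{ does not admit a grading}\}\subset\mathrm{H}_A.$$ Then $\mathcal{J}^{gr}\subset\mathrm{H}_A$ is a Hopf ideal.
   Context: A monoid $A$ is an associative semigroup with identity $1$ and absorbing element $0$ (not necessarily commutative). An $A$-module is a pointed set $(M,0_M)$ with an action $A\times M\to M$ satisfying $(ab)m=a(bm)$, $1m=m$, $0m=0_M$, $a0_M=0_M$; morphisms are pointed equivariant maps; submodules are pointed subsets preserved by $A$. All modules are finite sets, and $\dim M=|M|-1$. $M\oplus N$ is the wedge (disjoint union with basepoints identified); for a submodule $N\subset M$, $M/N$ is $M$ with all elements of $N$ identified with the basepoint. $\overline M$ is the isomorphism class of $M$, and $\delta_{\overline M}$ is the function on isomorphism classes that is $1$ on $\overline M$ and $0$ elsewhere. $A$ is $\Gamma$-graded if $A=\bigoplus_{\gamma\in\Gamma}A_\gamma$ as pointed sets (each $A_\gamma$ a pointed subset containing $0$, with union $A$ and pairwise intersections $\{0\}$), with $1\in A_0$ and $A_\gamma\cdot A_\delta\subset A_{\gamma+\delta}$. A module $M$ admits a grading if there is a decomposition $M=\bigoplus_{\gamma\in\Gamma}M_\gamma$ as pointed sets (in the same sense) with $A_\gamma\cdot M_\delta\subset M_{\gamma+\delta}$. The Hall algebra $\mathrm{H}_A$ is the $\mathbb{Q}$-vector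 space of finitely supported functions from isomorphism classes of finite $A$-modules to $\mathbb{Q}$, with product $(f\star g)(\overline M)=\sum_{N\subset M}f(\overline{M/N})\,g(\overline N)$ (sum over all submodules $N\subset M$), unit $\delta_{\overline{0}}$, coproduct $\Delta(f)(\overline M,\overline N)=f(\overline{M\oplus N})$, counit $f\mapsto f(\overline 0)$, and grading $\deg\delta_{\overline M}=\dim M$. It is a graded, connected, co-commutative bialgebra, hence a Hopf algebra. *)

theory Defs
  imports Complex_Main "HOL-Library.Poly_Mapping"
begin

section \<open>Monoids with absorbing element\<close>

text \<open>
  A (not necessarily commutative) monoid with identity \<open>1\<close> and absorbing element \<open>0\<close> is a type
  of sort \<open>{monoid_mult, mult_zero}\<close>. The axiom \<open>0 \<noteq> 1\<close> is not imposed.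
\<close>

inductive_set monoid_gen :: "'a::{monoid_mult,mult_zero} set \<Rightarrow> 'a set" for S where
  zero: "0 \<in> monoid_gen S"
| one: "1 \<in> monoid_gen S"
| gen: "s \<in> S \<Longrightarrow> s \<in> monoid_gen S"
| mult: "a \<in> monoid_gen S \<Longrightarrow> b \<in> monoid_gen S \<Longrightarrow> a * b \<in> monoid_gen S"

definition pointed_decomp :: "'x set \<Rightarrow> 'x \<Rightarrow> ('g \<Rightarrow> 'x set) \<Rightarrow> bool" where
  "pointed_decomp X p D \<longleftrightarrow>
     (\<forall>\<gamma>. p \<in> D \<gamma>) \<and> (\<Union>\<gamma>. D \<gamma>) = X \<and> (\<forall>\<gamma> \<delta>. \<gamma> \<noteq> \<delta> \<longrightarrow> D \<gamma> \<inter> D \<delta> = {p})"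

definition monoid_grading :: "('g::comm_monoid_add \<Rightarrow> 'a::{monoid_mult,mult_zero} set) \<Rightarrow> bool" where
  "monoid_grading A \<longleftrightarrow>
     pointed_decomp UNIV 0 A \<and> 1 \<in> A 0 \<and>
     (\<forall>\<gamma> \<delta>. \<forall>a\<in>A \<gamma>. \<forall>b\<in>A \<delta>. a * b \<in> A (\<gamma> + \<delta>))"

section \<open>Finite modules\<close>

record ('a, 'm) amod =
  carrier :: "'m set"
  base :: 'm
  act :: "'a \<Rightarrow> 'm \<Rightarrow> 'm"

definition finite_module :: "('a::{monoid_mult,mult_zero}, 'm) amod \<Rightarrow> bool" where
  "finite_module M \<longleftrightarrow>
     finite (carrier M) \<and> base M \<in> carrier M \<and>
     (\<forall>a. \<forall>m\<in>carrier M. act M a m \<in> carrier M) \<and>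
     (\<forall>a b. \<forall>m\<in>carrier M. act M (a * b) m = act M a (act M b m)) \<and>
     (\<forall>m\<in>carrier M. act M 1 m = m) \<and>
     (\<forall>m\<in>carrier M. act M 0 m = base M) \<and>
     (\<forall>a. act M a (base M) = base M)"

definition module_iso :: "('a, 'm) amod \<Rightarrow> ('a, 'n) amod \<Rightarrow> bool" where
  "module_iso M N \<longleftrightarrow> (\<exists>h. bij_betw h (carrier M) (carrier N) \<and> h (base M) = base N \<and>
     (\<forall>a. \<forall>m\<in>carrier M. h (act M a m) = act N a (h m)))"

definition submodule :: "'m set \<Rightarrow> ('a, 'm) amod \<Rightarrow> bool" where
  "submodule N M \<longleftrightarrow>
     N \<subseteq> carrier M \<and> base M \<in> N \<and> (\<forall>a. \<forall>m\<in>N. act M a m \<in> N)"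

definition restrict_module :: "('a, 'm) amod \<Rightarrow> 'm set \<Rightarrow> ('a, 'm) amod" where
  "restrict_module M N = M\<lparr>carrier := N\<rparr>"

definition quotient_module :: "('a, 'm) amod \<Rightarrow> 'm set \<Rightarrow> ('a, 'm) amod" where
  "quotient_module M N =
     \<lparr>carrier = insert (base M) (carrier M - N), base = base M,
      act = (\<lambda>a m. if act M a m \<in> N then base M else act M a m)\<rparr>"

text \<open>The wedge sum; \<open>Inl (base M)\<close> is the common basepoint, and \<open>Inr (base N)\<close> is not used.\<close>

definition wedge :: "('a, 'm) amod \<Rightarrow> ('a, 'n) amod \<Rightarrow> ('a, 'm + 'n) amod" where
  "wedge M N =
     \<lparr>carrier = Inl ` carrier M \<union> Inr ` (carrier N - {base N}), base = Inl (base M),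
      act = (\<lambda>a x. case x of
               Inl m \<Rightarrow> Inl (act M a m)
             | Inr n \<Rightarrow> if act N a n = base N then Inl (base M) else Inr (act N a n))\<rparr>"

definition zero_module :: "('a, nat) amod" where
  "zero_module = \<lparr>carrier = {0}, base = 0, act = (\<lambda>_ _. 0)\<rparr>"

definition admits_grading ::
  "('g::comm_monoid_add \<Rightarrow> 'a set) \<Rightarrow> ('a, 'm) amod \<Rightarrow> bool" where
  "admits_grading A M \<longleftrightarrow> (\<exists>D. pointed_decomp (carrier M) (base M) D \<and>
     (\<forall>\<gamma> \<delta>. \<forall>a\<in>A \<gamma>. \<forall>m\<in>D \<delta>. act M a m \<in> D (\<gamma> + \<delta>)))"

section \<open>Isomorphism classes of finite modules\<close>

text \<open>
  Every finite module is isomorphic to one whose carrier is a set of natural numbers, so modules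
  over \<open>nat\<close> represent all isomorphism classes. The class of a module with carrier in an
  arbitrary type is the set of all finite modules over \<open>nat\<close> isomorphic to it.
\<close>

lemma finite_module_zero: "finite_module zero_module"
  by (simp add: finite_module_def zero_module_def)

typedef (overloaded) 'a::"{monoid_mult,mult_zero}" iso_class =
  "{{N :: ('a, nat) amod. finite_module N \<and> module_iso M N} | M :: ('a, nat) amod. finite_module M}"
  using finite_module_zero by blast

definition class_of :: "('a::{monoid_mult,mult_zero}, 'm) amod \<Rightarrow> 'a iso_class" where
  "class_of M = Abs_iso_class {N. finite_module N \<and> module_iso M N}"

definition rep :: "'a::{monoid_mult,mult_zero} iso_class \<Rightarrow> ('a, nat) amod" where
  "rep C = (SOME M. M \<in> Rep_iso_class C)"

section \<open>Linear algebra of finitely supported functions\<close>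

definition pm_scale :: "'k::field \<Rightarrow> ('b \<Rightarrow>\<^sub>0 'k) \<Rightarrow> ('b \<Rightarrow>\<^sub>0 'k)" where
  "pm_scale c f = Poly_Mapping.map ((*) c) f"

lemma lookup_pm_scale: "Poly_Mapping.lookup (pm_scale c f) x = c * Poly_Mapping.lookup f x"
  by (simp add: pm_scale_def Poly_Mapping.map.rep_eq when_def)

global_interpretation pm: vector_space pm_scale
  defines pm_subspace = pm.subspace and pm_span = pm.span
  by unfold_locales
    (auto intro!: poly_mapping_eqI simp: lookup_pm_scale lookup_add algebra_simps)

text \<open>
  The tensor product of the spaces with bases \<open>'b\<close> and \<open>'c\<close> is the space with basis \<open>'b \<times> 'c\<close>.
\<close>

definition tensor :: "('b \<Rightarrow>\<^sub>0 'k::field) \<Rightarrow> ('c \<Rightarrow>\<^sub>0 'k) \<Rightarrow> ('b \<times> 'c \<Rightarrow>\<^sub>0 'k)" where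
  "tensor f g =
     Abs_poly_mapping (\<lambda>(x, y). Poly_Mapping.lookup f x * Poly_Mapping.lookup g y)"

section \<open>Antipodes and Hopf ideals\<close>

text \<open>
  The convolution \<open>mult \<circ> (S \<otimes> T) \<circ> comult\<close> of two linear endomorphisms, with
  \<open>comult f\<close> expanded in the basis of the tensor square.
\<close>

definition convolution ::
  "(('b \<Rightarrow>\<^sub>0 'k::field) \<Rightarrow> ('b \<Rightarrow>\<^sub>0 'k) \<Rightarrow> ('b \<Rightarrow>\<^sub>0 'k)) \<Rightarrow>
   (('b \<Rightarrow>\<^sub>0 'k) \<Rightarrow> ('b \<times> 'b \<Rightarrow>\<^sub>0 'k)) \<Rightarrow>
   (('b \<Rightarrow>\<^sub>0 'k) \<Rightarrow> ('b \<Rightarrow>\<^sub>0 'k)) \<Rightarrow> (('b \<Rightarrow>\<^sub>0 'k) \<Rightarrow> ('b \<Rightarrow>\<^sub>0 'k)) \<Rightarrow>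
   ('b \<Rightarrow>\<^sub>0 'k) \<Rightarrow> ('b \<Rightarrow>\<^sub>0 'k)" where
  "convolution mult comult S T f =
     (\<Sum>(x, y)\<in>Poly_Mapping.keys (comult f).
        pm_scale (Poly_Mapping.lookup (comult f) (x, y))
          (mult (S (Poly_Mapping.single x 1)) (T (Poly_Mapping.single y 1))))"

definition is_antipode ::
  "(('b \<Rightarrow>\<^sub>0 'k::field) \<Rightarrow> ('b \<Rightarrow>\<^sub>0 'k) \<Rightarrow> ('b \<Rightarrow>\<^sub>0 'k)) \<Rightarrow> ('b \<Rightarrow>\<^sub>0 'k) \<Rightarrow>
   (('b \<Rightarrow>\<^sub>0 'k) \<Rightarrow> ('b \<times> 'b \<Rightarrow>\<^sub>0 'k)) \<Rightarrow> (('b \<Rightarrow>\<^sub>0 'k) \<Rightarrow> 'k) \<Rightarrow>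
   (('b \<Rightarrow>\<^sub>0 'k) \<Rightarrow> ('b \<Rightarrow>\<^sub>0 'k)) \<Rightarrow> bool" where
  "is_antipode mult one comult counit S \<longleftrightarrow>
     Vector_Spaces.linear pm_scale pm_scale S \<and>
     (\<forall>f. convolution mult comult S id f = pm_scale (counit f) one \<and>
          convolution mult comult id S f = pm_scale (counit f) one)"

text \<open>
  A Hopf ideal is a two-sided ideal that is a coideal and is stable under the antipode. The
  existence of the antipode is part of the condition; its uniqueness is automatic in a bialgebra.
\<close>

definition hopf_ideal ::
  "(('b \<Rightarrow>\<^sub>0 'k::field) \<Rightarrow> ('b \<Rightarrow>\<^sub>0 'k) \<Rightarrow> ('b \<Rightarrow>\<^sub>0 'k)) \<Rightarrow> ('b \<Rightarrow>\<^sub>0 'k) \<Rightarrow>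
   (('b \<Rightarrow>\<^sub>0 'k) \<Rightarrow> ('b \<times> 'b \<Rightarrow>\<^sub>0 'k)) \<Rightarrow> (('b \<Rightarrow>\<^sub>0 'k) \<Rightarrow> 'k) \<Rightarrow>
   ('b \<Rightarrow>\<^sub>0 'k) set \<Rightarrow> bool" where
  "hopf_ideal mult one comult counit J \<longleftrightarrow>
     pm_subspace J \<and>
     (\<forall>f\<in>J. \<forall>h. mult h f \<in> J \<and> mult f h \<in> J) \<and>
     (\<forall>f\<in>J. comult f \<in> pm_span ({tensor g h | g h. g \<in> J} \<union> {tensor g h | g h. h \<in> J})) \<and>
     (\<forall>f\<in>J. counit f = 0) \<and>
     (\<exists>S. is_antipode mult one comult counit S \<and> S ` J \<subseteq> J)"

section \<open>The Hall algebra\<close>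

type_synonym 'a hall = "'a iso_class \<Rightarrow>\<^sub>0 rat"

definition delta :: "('a::{monoid_mult,mult_zero}, 'm) amod \<Rightarrow> 'a hall" where
  "delta M = Poly_Mapping.single (class_of M) 1"

text \<open>
  For finitely generated \<open>'a\<close> the function under \<open>Abs_poly_mapping\<close> has finite support, since
  there are only finitely many classes of modules of each dimension. Without finite generation
  this can fail, and then the value is unspecified.
\<close>

definition hall_mult ::
  "'a::{monoid_mult,mult_zero} hall \<Rightarrow> 'a hall \<Rightarrow> 'a hall" where
  "hall_mult f g = Abs_poly_mapping (\<lambda>C.
     \<Sum>N | submodule N (rep C).
       Poly_Mapping.lookup f (class_of (quotient_module (rep C) N)) *
       Poly_Mapping.lookup g (class_of (restrict_module (rep C) N)))"

definition hall_one :: "'a::{monoid_mult,mult_zero} hall" where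
  "hall_one = delta zero_module"

definition hall_comult ::
  "'a::{monoid_mult,mult_zero} hall \<Rightarrow> ('a iso_class \<times> 'a iso_class \<Rightarrow>\<^sub>0 rat)" where
  "hall_comult f = Abs_poly_mapping (\<lambda>(C, D).
     Poly_Mapping.lookup f (class_of (wedge (rep C) (rep D))))"

definition hall_counit :: "'a::{monoid_mult,mult_zero} hall \<Rightarrow> rat" where
  "hall_counit f = Poly_Mapping.lookup f (class_of zero_module)"

definition J_gr ::
  "('g::comm_monoid_add \<Rightarrow> 'a::{monoid_mult,mult_zero} set) \<Rightarrow> 'a hall set" where
  "J_gr A = pm_span {delta M | M :: ('a, nat) amod. finite_module M \<and> \<not> admits_grading A M}"

end

theory Submission
  imports Defs
begin

text \<open>
  A grading of a module restricts to submodules and descends to quotients, and gradings of two modules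
  combine to one of their wedge. Hence the classes without a grading span a two-sided ideal and a coideal.

  For the antipode, write the coproduct of a basis element as the sum over the decompositions of its
  class as a wedge of two classes. Wedge sum makes the isomorphism classes an associative
  monoid graded by dimension, so convolution becomes an associative product of functions on classes,
  in which a function with value \<open>1\<close> at the zero class is inverted by recursion on the dimension.
  The same recursion shows that the inverse of the identity preserves the ideal.
\<close>

section \<open>Isomorphisms, submodules and quotients\<close>

text \<open>The ideal is spanned by basis vectors, so membership is a condition on supports: with B
  the set of classes without a grading, f lies in the ideal iff its support lies in B. Each ideal
  axiom then becomes a statement about B, obtained by contraposition from an inheritance property of
  gradings. The functions under \<open>Abs_poly_mapping\<close> in the product and the coproduct
  carry meaning only if their supports are finite. This is where finite generation enters: an action
  on a given finite pointed set is determined by the generators, so each dimension has finitely many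
  classes, and products and wedge decompositions respect dimension. The recursion yields only a left
  convolution inverse. It is two-sided because this inverse again has value \<open>1\<close> at the
  zero class, hence has a left inverse of its own, which associativity identifies with the original
  function.\<close>

lemma finite_moduleD:
  assumes "finite_module M"
  shows "finite (carrier M)" "base M \<in> carrier M"
    "\<And>a m. m \<in> carrier M \<Longrightarrow> act M a m \<in> carrier M"
    "\<And>a b m. m \<in> carrier M \<Longrightarrow> act M (a * b) m = act M a (act M b m)"
    "\<And>m. m \<in> carrier M \<Longrightarrow> act M 1 m = m"
    "\<And>m. m \<in> carrier M \<Longrightarrow> act M 0 m = base M"
    "\<And>a. act M a (base M) = base M"
  using assms by (auto simp: finite_module_def)

lemma module_isoI:
  assumes "bij_betw h (carrier M) (carrier N)" "h (base M) = base N"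
    "\<And>a m. m \<in> carrier M \<Longrightarrow> h (act M a m) = act N a (h m)"
  shows "module_iso M N"
  using assms by (auto simp: module_iso_def)

text \<open>The base point and all translates of elements of \<open>M\<close> lie in its carrier,
  where the bijection can be inverted; this makes the inverse map pointed and equivariant.\<close>

lemma module_iso_sym:
  assumes M: "finite_module M" and "module_iso M N"
  shows "module_iso N M"
proof -
  obtain h where h: "bij_betw h (carrier M) (carrier N)" "h (base M) = base N"
    "\<And>a m. m \<in> carrier M \<Longrightarrow> h (act M a m) = act N a (h m)"
    using assms by (auto simp: module_iso_def)
  let ?k = "inv_into (carrier M) h"
  have k: "?k (h m) = m" if "m \<in> carrier M" for m
    using h(1) that by (simp add: bij_betw_inv_into_left)
  show ?thesis
  proof (rule module_isoI)
    show "bij_betw ?k (carrier N) (carrier M)"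
      using h(1) by (rule bij_betw_inv_into)
    show "?k (base N) = base M"
      using k h(2) finite_moduleD(2)[OF M] by metis
    fix a n assume "n \<in> carrier N"
    then obtain m where "m \<in> carrier M" "n = h m"
      using h(1) by (auto simp: bij_betw_def)
    then show "?k (act N a n) = act M a (?k n)"
      using k h(3) finite_moduleD(3)[OF M] by metis
  qed
qed

lemma module_iso_trans:
  assumes "module_iso L M" "module_iso M N"
  shows "module_iso L N"
proof -
  obtain h where h: "bij_betw h (carrier L) (carrier M)" "h (base L) = base M"
    "\<And>a m. m \<in> carrier L \<Longrightarrow> h (act L a m) = act M a (h m)"
    using assms(1) by (auto simp: module_iso_def)
  obtain k where k: "bij_betw k (carrier M) (carrier N)" "k (base M) = base N"
    "\<And>a m. m \<in> carrier M \<Longrightarrow> k (act M a m) = act N a (k m)"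
    using assms(2) by (auto simp: module_iso_def)
  have "h m \<in> carrier M" if "m \<in> carrier L" for m
    using h(1) that by (auto simp: bij_betw_def)
  then show ?thesis
    using h k by (intro module_isoI[of "k \<circ> h"]) (auto intro: bij_betw_trans)
qed

lemma module_iso_same_carrier:
  assumes "carrier M = carrier N" "base M = base N"
    "\<And>a m. m \<in> carrier M \<Longrightarrow> act M a m = act N a m"
  shows "module_iso M N"
  using assms by (intro module_isoI[of id]) auto

lemma module_iso_refl: "module_iso M M"
  by (rule module_iso_same_carrier) auto

lemma module_iso_card: "module_iso M N \<Longrightarrow> card (carrier M) = card (carrier N)"
  by (auto simp: module_iso_def bij_betw_same_card)

section \<open>Transport of structure and representatives over the natural numbers\<close>

lemma module_transport:
  assumes M: "finite_module M" and h: "bij_betw h (carrier M) X"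
  obtains N where "finite_module N" "module_iso M N" "carrier N = X"
proof -
  define N where "N = \<lparr>carrier = X, base = h (base M),
    act = (\<lambda>a x. h (act M a (inv_into (carrier M) h x)))\<rparr>"
  have inv: "inv_into (carrier M) h (h m) = m" if "m \<in> carrier M" for m
    using h that by (simp add: bij_betw_inv_into_left)
  have X: "X = h ` carrier M"
    using h by (simp add: bij_betw_def)
  have "finite_module N"
    using finite_moduleD[OF M] by (auto simp: finite_module_def N_def X inv)
  moreover have "module_iso M N"
    by (rule module_isoI[of h]) (use h in \<open>auto simp: N_def inv\<close>)
  ultimately show thesis
    by (rule that) (simp add: N_def)
qed

lemma finite_module_initial_segment:
  assumes "finite_module M"
  obtains N :: "('a::{monoid_mult,mult_zero}, nat) amod"
    where "finite_module N" "module_iso M N" "carrier N = {0..<card (carrier M)}"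
  using module_transport[OF assms] ex_bij_betw_finite_nat[OF finite_moduleD(1)[OF assms]]
  by metis

text \<open>The type of classes is built from modules over \<open>nat\<close>, whereas
  \<open>M\<close> may live over any type. A copy \<open>K\<close> of \<open>M\<close> over
  \<open>nat\<close> has the same isomorphic modules, so the set behind \<open>class_of M\<close>
  belongs to the representing set of the type.\<close>

lemma Rep_class_of:
  assumes M: "finite_module M"
  shows "Rep_iso_class (class_of M) = {N. finite_module N \<and> module_iso M N}"
proof -
  obtain K :: "('a, nat) amod" where K: "finite_module K" "module_iso M K"
    using finite_module_initial_segment[OF M] by metis
  have "{N :: ('a, nat) amod. finite_module N \<and> module_iso M N} = {N. finite_module N \<and> module_iso K N}"
    using module_iso_trans[OF K(2)] module_iso_trans[OF module_iso_sym[OF M K(2)]] by auto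
  with K(1) show ?thesis
    unfolding class_of_def by (subst Abs_iso_class_inverse) auto
qed

lemma class_of_eq_iff:
  assumes "finite_module M" "finite_module N"
  shows "class_of M = class_of N \<longleftrightarrow> module_iso M N"
proof
  assume eq: "class_of M = class_of N"
  obtain K :: "('a, nat) amod" where K: "finite_module K" "module_iso M K"
    using finite_module_initial_segment[OF assms(1)] by metis
  with eq assms have "K \<in> Rep_iso_class (class_of N)"
    by (metis (mono_tags, lifting) Rep_class_of mem_Collect_eq)
  then show "module_iso M N"
    using K assms by (auto simp: Rep_class_of intro: module_iso_sym module_iso_trans)
next
  assume "module_iso M N"
  then have "Rep_iso_class (class_of M) = Rep_iso_class (class_of N)"
    using assms by (auto simp: Rep_class_of intro: module_iso_sym module_iso_trans)
  then show "class_of M = class_of N"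
    by (simp add: Rep_iso_class_inject)
qed

lemma class_of_cong: "finite_module M \<Longrightarrow> finite_module N \<Longrightarrow> module_iso M N \<Longrightarrow> class_of M = class_of N"
  by (simp add: class_of_eq_iff)

lemma
  shows finite_module_rep [simp]: "finite_module (rep C)"
    and class_of_rep [simp]: "class_of (rep C) = C"
proof -
  obtain M :: "('a, nat) amod" where
    M: "finite_module M" "Rep_iso_class C = {N. finite_module N \<and> module_iso M N}"
    using Rep_iso_class[of C] by auto
  have "C = class_of M"
    using M by (simp add: Rep_class_of flip: Rep_iso_class_inject)
  moreover have "rep C \<in> Rep_iso_class C"
    unfolding rep_def by (rule someI[of _ M]) (use M module_iso_refl in auto)
  ultimately show "finite_module (rep C)" "class_of (rep C) = C"
    using M by (auto simp: class_of_eq_iff intro: module_iso_sym)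
qed

lemma rep_class_of_iso: "finite_module M \<Longrightarrow> module_iso (rep (class_of M)) M"
  by (simp flip: class_of_eq_iff)

section \<open>Submodules, quotients and their behaviour under isomorphism\<close>

lemma submoduleD:
  assumes "submodule N M"
  shows "N \<subseteq> carrier M" "base M \<in> N" "\<And>a m. m \<in> N \<Longrightarrow> act M a m \<in> N"
  using assms by (auto simp: submodule_def)

lemma finite_submodules: "finite_module M \<Longrightarrow> finite {N. submodule N M}"
  by (rule finite_subset[of _ "Pow (carrier M)"]) (auto simp: submodule_def finite_module_def)

lemma restrict_module_simps [simp]:
  "carrier (restrict_module M N) = N" "base (restrict_module M N) = base M"
  "act (restrict_module M N) = act M"
  by (simp_all add: restrict_module_def)

lemma quotient_module_simps [simp]:
  "carrier (quotient_module M N) = insert (base M) (carrier M - N)"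
  "base (quotient_module M N) = base M"
  "act (quotient_module M N) a m = (if act M a m \<in> N then base M else act M a m)"
  by (simp_all add: quotient_module_def)

lemma finite_module_restrict:
  assumes "finite_module M" "submodule N M"
  shows "finite_module (restrict_module M N)"
  using finite_moduleD[OF assms(1)] submoduleD[OF assms(2)]
  by (auto simp: finite_module_def intro: finite_subset)

lemma finite_module_quotient:
  assumes "finite_module M" "submodule N M"
  shows "finite_module (quotient_module M N)"
  using finite_moduleD[OF assms(1)] submoduleD[OF assms(2)]
  by (auto simp: finite_module_def)

text \<open>The base point is counted both in the quotient and in \<open>N\<close>, hence the extra
  \<open>1\<close>; the additive form avoids truncated subtraction.\<close>

lemma card_quotient_module:
  assumes "finite_module M" "submodule N M"
  shows "card (carrier M) + 1 = card (carrier (quotient_module M N)) + card N"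
proof -
  have fin: "finite (carrier M)" "finite N" and N: "N \<subseteq> carrier M" "base M \<in> N"
    using finite_moduleD(1)[OF assms(1)] submoduleD(1,2)[OF assms(2)] by (auto dest: finite_subset)
  then have "card (insert (base M) (carrier M - N)) = card (carrier M) - card N + 1"
    by (simp add: card_Diff_subset)
  then show ?thesis
    using card_mono[OF fin(1) N(1)] by simp
qed

lemma submodule_iso_image:
  assumes M: "finite_module M" and N: "submodule N M"
    and h: "bij_betw h (carrier M) (carrier M')" "h (base M) = base M'"
      "\<And>a m. m \<in> carrier M \<Longrightarrow> h (act M a m) = act M' a (h m)"
  shows "submodule (h ` N) M'"
    and "module_iso (restrict_module M N) (restrict_module M' (h ` N))"
    and "module_iso (quotient_module M N) (quotient_module M' (h ` N))"
proof -
  note S = submoduleD[OF N]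
  have inj: "inj_on h (carrier M)" and im: "h ` carrier M = carrier M'"
    using h(1) by (auto simp: bij_betw_def)
  have mem: "h m \<in> h ` N \<longleftrightarrow> m \<in> N" if "m \<in> carrier M" for m
    using inj that S(1) by (rule inj_on_image_mem_iff)
  show "submodule (h ` N) M'"
    unfolding submodule_def
  proof (intro conjI allI ballI)
    show "h ` N \<subseteq> carrier M'" using S(1) im by blast
    show "base M' \<in> h ` N" using S h(2) by (metis imageI)
    fix a x assume "x \<in> h ` N"
    then obtain m where m: "m \<in> N" "x = h m" by auto
    then have "act M' a x = h (act M a m)" using h(3) S(1) by auto
    then show "act M' a x \<in> h ` N" using S(3) m by auto
  qed
  show "module_iso (restrict_module M N) (restrict_module M' (h ` N))"
  proof (rule module_isoI[of h])
    show "bij_betw h (carrier (restrict_module M N)) (carrier (restrict_module M' (h ` N)))"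
      using inj S(1) by (auto simp: bij_betw_def intro: inj_on_subset)
  qed (use h S in auto)
  show "module_iso (quotient_module M N) (quotient_module M' (h ` N))"
  proof (rule module_isoI[of h])
    have "insert (base M) (carrier M - N) \<subseteq> carrier M"
      using finite_moduleD(2)[OF M] by auto
    moreover have "h ` insert (base M) (carrier M - N) = insert (base M') (carrier M' - h ` N)"
      using h(2) im S(1) inj by (simp add: inj_on_image_set_diff)
    ultimately show "bij_betw h (carrier (quotient_module M N)) (carrier (quotient_module M' (h ` N)))"
      unfolding bij_betw_def quotient_module_simps by (intro conjI inj_on_subset[OF inj])
    fix a m assume "m \<in> carrier (quotient_module M N)"
    then have m: "m \<in> carrier M" using finite_moduleD(2)[OF M] by auto
    then show "h (act (quotient_module M N) a m) = act (quotient_module M' (h ` N)) a (h m)"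
      using mem[OF finite_moduleD(3)[OF M m]] h by auto
  qed (use h in auto)
qed

text \<open>Taking images under an isomorphism is a bijection between the submodules of both modules
  that keeps the classes of quotient and submodule. Hence the Hall product does not depend on the
  representative chosen by \<open>rep\<close>.\<close>

lemma sum_submodules_iso:
  fixes f g :: "'a::{monoid_mult,mult_zero} iso_class \<Rightarrow> 'k::comm_semiring_0"
  assumes M: "finite_module M" and M': "finite_module M'" and iso: "module_iso M M'"
  shows "(\<Sum>N | submodule N M. f (class_of (quotient_module M N)) * g (class_of (restrict_module M N))) =
    (\<Sum>N | submodule N M'. f (class_of (quotient_module M' N)) * g (class_of (restrict_module M' N)))"
proof -
  obtain h where h: "bij_betw h (carrier M) (carrier M')" "h (base M) = base M'"
    "\<And>a m. m \<in> carrier M \<Longrightarrow> h (act M a m) = act M' a (h m)"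
    using iso by (auto simp: module_iso_def)
  let ?k = "inv_into (carrier M) h"
  have hk: "h (?k x) = x" if "x \<in> carrier M'" for x
    using h(1) that by (simp add: bij_betw_inv_into_right)
  have kh: "?k (h m) = m" if "m \<in> carrier M" for m
    using h(1) that by (simp add: bij_betw_inv_into_left)
  have k: "bij_betw ?k (carrier M') (carrier M)" "?k (base M') = base M"
    "\<And>a m. m \<in> carrier M' \<Longrightarrow> ?k (act M' a m) = act M a (?k m)"
  proof -
    show *: "bij_betw ?k (carrier M') (carrier M)"
      using h(1) by (rule bij_betw_inv_into)
    show "?k (base M') = base M"
      using kh h(2) finite_moduleD(2)[OF M] by metis
    fix a m assume m: "m \<in> carrier M'"
    then have "?k m \<in> carrier M" using * by (auto simp: bij_betw_def)
    then show "?k (act M' a m) = act M a (?k m)"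
      using kh h(3) finite_moduleD(3)[OF M] hk[OF m] by metis
  qed
  show ?thesis
  proof (rule sum.reindex_bij_witness[of _ "\<lambda>N. ?k ` N" "\<lambda>N. h ` N"])
    fix N assume "N \<in> {N. submodule N M}"
    then have N: "submodule N M" by simp
    note im = submodule_iso_image[OF M N h]
    show "h ` N \<in> {N. submodule N M'}" using im by simp
    show "?k ` h ` N = N"
      using submoduleD(1)[OF N] kh by (force simp: image_image)
    have "class_of (quotient_module M N) = class_of (quotient_module M' (h ` N))"
      "class_of (restrict_module M N) = class_of (restrict_module M' (h ` N))"
      using im N M M' by (auto intro!: class_of_cong finite_module_quotient finite_module_restrict)
    then show "f (class_of (quotient_module M' (h ` N))) * g (class_of (restrict_module M' (h ` N))) =
      f (class_of (quotient_module M N)) * g (class_of (restrict_module M N))" by simp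
  next
    fix N assume "N \<in> {N. submodule N M'}"
    then have N: "submodule N M'" by simp
    show "?k ` N \<in> {N. submodule N M}"
      using submodule_iso_image(1)[OF M' N k] by simp
    show "h ` ?k ` N = N"
      using submoduleD(1)[OF N] hk by (force simp: image_image)
  qed
qed

section \<open>The monoid of isomorphism classes\<close>

lemma wedge_simps [simp]:
  "carrier (wedge M N) = Inl ` carrier M \<union> Inr ` (carrier N - {base N})"
  "base (wedge M N) = Inl (base M)"
  "act (wedge M N) a (Inl m) = Inl (act M a m)"
  "act (wedge M N) a (Inr n) = (if act N a n = base N then Inl (base M) else Inr (act N a n))"
  by (simp_all add: wedge_def)

lemma zero_module_simps [simp]:
  "carrier zero_module = {0}" "base zero_module = 0" "act zero_module a m = 0"
  by (simp_all add: zero_module_def)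

lemma finite_module_wedge:
  assumes "finite_module M" "finite_module N"
  shows "finite_module (wedge M N)"
  using finite_moduleD[OF assms(1)] finite_moduleD[OF assms(2)]
  by (auto simp: finite_module_def split: if_splits)

text \<open>The identified base point is counted once in the wedge and twice in the two
  summands.\<close>

lemma card_wedge:
  assumes "finite_module M" "finite_module N"
  shows "card (carrier (wedge M N)) + 1 = card (carrier M) + card (carrier N)"
proof -
  note M = finite_moduleD[OF assms(1)] and N = finite_moduleD[OF assms(2)]
  have "card (carrier (wedge M N)) = card (Inl ` carrier M :: ('b + 'c) set) +
      card (Inr ` (carrier N - {base N}) :: ('b + 'c) set)"
    using M N by (simp, intro card_Un_disjoint) auto
  also have "\<dots> + 1 = card (carrier M) + card (carrier N)"
    using N(1,2) card_gt_0_iff[of "carrier N"] by (auto simp: card_image card_Diff_singleton)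
  finally show ?thesis .
qed

lemma wedge_iso_cong:
  assumes M: "finite_module M" "finite_module M'" "module_iso M M'"
    and N: "finite_module N" "finite_module N'" "module_iso N N'"
  shows "module_iso (wedge M N) (wedge M' N')"
proof -
  obtain h where h: "bij_betw h (carrier M) (carrier M')" "h (base M) = base M'"
    "\<And>a m. m \<in> carrier M \<Longrightarrow> h (act M a m) = act M' a (h m)"
    using M by (auto simp: module_iso_def)
  obtain k where k: "bij_betw k (carrier N) (carrier N')" "k (base N) = base N'"
    "\<And>a m. m \<in> carrier N \<Longrightarrow> k (act N a m) = act N' a (k m)"
    using N by (auto simp: module_iso_def)
  \<comment> \<open>The right half of the wedge action branches on whether the result is the base
    point; injectivity of \<open>k\<close> makes both sides take the same branch.\<close>
  have k0: "k x = base N' \<longleftrightarrow> x = base N" if "x \<in> carrier N" for x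
    using k(1,2) that finite_moduleD(2)[OF N(1)] by (auto simp: bij_betw_def inj_on_def)
  have k1: "act N' a (k x) = base N' \<longleftrightarrow> act N a x = base N" if "x \<in> carrier N" for a x
    using k(3)[OF that] k0[OF finite_moduleD(3)[OF N(1) that]] by simp
  have "bij_betw k (carrier N - {base N}) (carrier N' - {base N'})"
    using bij_betw_DiffI[OF k(1), of "{base N}" "{base N'}"] k(2) finite_moduleD(2)[OF N(1)]
    finite_moduleD(2)[OF N(2)]
    by (auto simp: bij_betw_def)
  then have k': "inj_on k (carrier N - {base N})" "k ` (carrier N - {base N}) = carrier N' - {base N'}"
    by (auto simp: bij_betw_def)
  show ?thesis
  proof (rule module_isoI[of "map_sum h k"])
    show "bij_betw (map_sum h k) (carrier (wedge M N)) (carrier (wedge M' N'))"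
      unfolding bij_betw_def
    proof
      show "inj_on (map_sum h k) (carrier (wedge M N))"
        using bij_betw_imp_inj_on[OF h(1)] bij_betw_imp_inj_on[OF k(1)]
        by (auto intro!: inj_onI dest: inj_onD)
      have "map_sum h k ` carrier (wedge M N) = Inl ` h ` carrier M \<union> Inr ` k ` (carrier N - {base N})"
        by (simp add: image_Un image_image)
      then show "map_sum h k ` carrier (wedge M N) = carrier (wedge M' N')"
        using h(1) k'(2) by (simp add: bij_betw_def)
    qed
    show "map_sum h k (base (wedge M N)) = base (wedge M' N')"
      using h by simp
    fix a x assume "x \<in> carrier (wedge M N)"
    then show "map_sum h k (act (wedge M N) a x) = act (wedge M' N') a (map_sum h k x)"
      using h(2,3) k(3) k1 by (auto split: if_splits)
  qed
qed

lemma wedge_assoc_iso: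
  assumes "finite_module L" "finite_module M" "finite_module N"
  shows "module_iso (wedge (wedge L M) N) (wedge L (wedge M N))"
proof -
  define h where "h = (\<lambda>x :: ('b + 'c) + 'd. case x of Inl (Inl l) \<Rightarrow> Inl l | Inl (Inr m) \<Rightarrow> Inr (Inl m) | Inr n \<Rightarrow> Inr (Inr n))"
  show ?thesis
  proof (rule module_isoI[of h])
    show "bij_betw h (carrier (wedge (wedge L M) N)) (carrier (wedge L (wedge M N)))"
      unfolding bij_betw_def
    proof
      show "inj_on h (carrier (wedge (wedge L M) N))"
        by (auto simp: inj_on_def h_def split: sum.splits)
      \<comment> \<open>The outer wedge removes the base point of \<open>wedge M N\<close>, which is
        \<open>Inl (base M)\<close>, so the elements other than the base points of \<open>M\<close>
        and \<open>N\<close> remain.\<close>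
      have *: "Inl ` carrier M \<union> Inr ` (carrier N - {base N}) - {Inl (base M)} =
          Inl ` (carrier M - {base M}) \<union> Inr ` (carrier N - {base N})"
        by auto
      show "h ` carrier (wedge (wedge L M) N) = carrier (wedge L (wedge M N))"
        by (simp add: h_def image_Un image_image Un_assoc *)
    qed
    show "h (base (wedge (wedge L M) N)) = base (wedge L (wedge M N))"
      by (simp add: h_def)
    fix a x assume "x \<in> carrier (wedge (wedge L M) N)"
    then show "h (act (wedge (wedge L M) N) a x) = act (wedge L (wedge M N)) a (h x)"
      by (auto simp: h_def split: if_splits)
  qed
qed

lemma wedge_zero_right_iso:
  assumes "finite_module M"
  shows "module_iso M (wedge M (zero_module :: ('a::{monoid_mult,mult_zero}, nat) amod))"
  by (rule module_isoI[of Inl]) (auto simp: bij_betw_def)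

text \<open>The base point of this wedge is the point of the zero module, so the isomorphism must
  send the left summand to \<open>base M\<close>.\<close>

lemma wedge_zero_left_iso:
  assumes "finite_module M"
  shows "module_iso (wedge (zero_module :: ('a::{monoid_mult,mult_zero}, nat) amod) M) M"
proof (rule module_isoI[of "case_sum (\<lambda>_. base M) id"])
  show "bij_betw (case_sum (\<lambda>_. base M) id) (carrier (wedge zero_module M)) (carrier M)"
    using finite_moduleD(2)[OF assms]
    by (auto simp: bij_betw_def inj_on_def image_Un image_image)
qed (use finite_moduleD(7)[OF assms] in \<open>auto split: if_splits\<close>)

text \<open>Dual to the coproduct: \<open>hall_comult f\<close> is \<open>f\<close> composed with
  this operation.\<close>

definition class_add :: "'a::{monoid_mult,mult_zero} iso_class \<Rightarrow> 'a iso_class \<Rightarrow> 'a iso_class" where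
  "class_add C D = class_of (wedge (rep C) (rep D))"

definition class_dim :: "'a::{monoid_mult,mult_zero} iso_class \<Rightarrow> nat" where
  "class_dim C = card (carrier (rep C)) - 1"

lemma class_dim_class_of: "finite_module M \<Longrightarrow> class_dim (class_of M) = card (carrier M) - 1"
  unfolding class_dim_def using module_iso_card[OF rep_class_of_iso] by metis

lemma class_add_class_of:
  assumes "finite_module M" "finite_module N"
  shows "class_add (class_of M) (class_of N) = class_of (wedge M N)"
  unfolding class_add_def using assms
  by (intro class_of_cong finite_module_wedge wedge_iso_cong rep_class_of_iso) auto

lemma class_add_assoc: "class_add (class_add B C) D = class_add B (class_add C D)"
proof -
  have "class_add (class_add B C) (class_of (rep D)) = class_of (wedge (wedge (rep B) (rep C)) (rep D))"
    unfolding class_add_def[of B C] by (intro class_add_class_of finite_module_wedge) auto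
  also have "\<dots> = class_of (wedge (rep B) (wedge (rep C) (rep D)))"
    by (intro class_of_cong finite_module_wedge wedge_assoc_iso) auto
  also have "\<dots> = class_add (class_of (rep B)) (class_add C D)"
    unfolding class_add_def[of C D] by (intro class_add_class_of[symmetric] finite_module_wedge) auto
  finally show ?thesis by simp
qed

lemma class_add_zero_right: "class_add C (class_of zero_module) = C"
proof -
  have "class_add (class_of (rep C)) (class_of zero_module) = class_of (wedge (rep C) (zero_module :: ('a, nat) amod))"
    by (intro class_add_class_of finite_module_zero) auto
  also have "\<dots> = class_of (rep C)"
    by (intro class_of_cong[symmetric] finite_module_wedge wedge_zero_right_iso finite_module_zero) auto
  finally show ?thesis by simp
qed

lemma class_add_zero_left: "class_add (class_of zero_module) C = C"
proof -
  have "class_add (class_of zero_module) (class_of (rep C)) = class_of (wedge (zero_module :: ('a, nat) amod) (rep C))"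
    by (intro class_add_class_of finite_module_zero) auto
  also have "\<dots> = class_of (rep C)"
    by (intro class_of_cong finite_module_wedge wedge_zero_left_iso finite_module_zero) auto
  finally show ?thesis by simp
qed

lemma card_carrier_pos: "finite_module M \<Longrightarrow> card (carrier M) > 0"
  by (auto simp: finite_module_def card_gt_0_iff)

lemma class_dim_add: "class_dim (class_add C D) = class_dim C + class_dim D"
proof -
  have "class_dim (class_add C D) = card (carrier (wedge (rep C) (rep D))) - 1"
    unfolding class_add_def by (intro class_dim_class_of finite_module_wedge) auto
  then show ?thesis
    using card_wedge[of "rep C" "rep D"] card_carrier_pos[of "rep C"] card_carrier_pos[of "rep D"]
    by (simp add: class_dim_def)
qed

lemma module_iso_zero_module:
  assumes "finite_module M" "carrier M = {base M}"
  shows "module_iso M zero_module"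
  by (rule module_isoI[of "\<lambda>_. 0"])
    (use assms in \<open>auto simp: bij_betw_def\<close>)

lemma class_of_eq_zero_iff:
  assumes M: "finite_module M"
  shows "class_of M = class_of zero_module \<longleftrightarrow> carrier M = {base M}"
proof
  assume "class_of M = class_of zero_module"
  then have "card (carrier M) = 1"
    using class_of_eq_iff[OF M finite_module_zero] module_iso_card by fastforce
  then show "carrier M = {base M}"
    using finite_moduleD(2)[OF M] by (metis card_1_singletonE singletonD)
qed (use M in \<open>auto intro!: class_of_cong module_iso_zero_module finite_module_zero\<close>)

text \<open>Connectedness of the Hall algebra: its degree zero part is spanned by the unit.\<close>

lemma class_dim_eq_0_iff: "class_dim C = 0 \<longleftrightarrow> C = class_of zero_module"
proof
  assume "class_dim C = 0"
  then have "card (carrier (rep C)) = 1"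
    using card_carrier_pos[of "rep C"] by (simp add: class_dim_def)
  then have "carrier (rep C) = {base (rep C)}"
    using finite_moduleD(2)[of "rep C"] finite_module_rep by (metis card_1_singletonE singletonD)
  then show "C = class_of zero_module"
    using class_of_eq_zero_iff[of "rep C"] by simp
qed (simp add: class_dim_class_of finite_module_zero)

text \<open>A class of dimension d has a representative on \<open>{0..<d + 1}\<close>, and such a
  module is determined up to isomorphism by its base point and the action of the generators. Only
  finitely many such data exist for d up to \<open>n\<close>.\<close>

lemma finite_classes_dim_le:
  fixes S :: "'a::{monoid_mult,mult_zero} set"
  assumes S: "finite S" "monoid_gen S = UNIV"
  shows "finite {C :: 'a iso_class. class_dim C \<le> n}"
proof -
  have ex: "\<exists>M :: ('a, nat) amod. finite_module M \<and> class_of M = C \<and> carrier M = {0..<class_dim C + 1}" for C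
  proof -
    obtain M :: "('a, nat) amod" where "finite_module M" "module_iso (rep C) M"
      "carrier M = {0..<card (carrier (rep C))}"
      using finite_module_initial_segment[OF finite_module_rep] by metis
    moreover from this have "class_of M = C"
      using class_of_cong[of "rep C" M] by simp
    ultimately show ?thesis
      using card_carrier_pos[of "rep C"] by (auto simp: class_dim_def intro!: exI[of _ M])
  qed
  define M where "M C = (SOME M :: ('a, nat) amod. finite_module M \<and> class_of M = C \<and> carrier M = {0..<class_dim C + 1})" for C
  have M: "finite_module (M C)" "class_of (M C) = C" "carrier (M C) = {0..<class_dim C + 1}" for C
    unfolding M_def using someI_ex[OF ex[of C]] by auto
  \<comment> \<open>A finite invariant of the class: the action enters through its graph on the
    generators only, so the values range over a finite set.\<close>
  define g where "g C = (carrier (M C), base (M C), {(s, m, act (M C) s m) | s m. s \<in> S \<and> m \<in> carrier (M C)})" for C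
  have "inj_on g {C. class_dim C \<le> n}"
  proof (rule inj_onI)
    fix C D assume "g C = g D"
    then have car: "carrier (M C) = carrier (M D)" and base: "base (M C) = base (M D)"
      and acts: "{(s, m, act (M C) s m) | s m. s \<in> S \<and> m \<in> carrier (M C)} =
        {(s, m, act (M D) s m) | s m. s \<in> S \<and> m \<in> carrier (M D)}"
      unfolding g_def prod.inject by - (elim conjE, assumption)+
    \<comment> \<open>Agreement spreads from \<open>S\<close> to products, while \<open>0\<close>
      and \<open>1\<close> act as the module axioms prescribe, given the common base point.\<close>
    have "\<forall>m\<in>carrier (M C). act (M C) a m = act (M D) a m" if "a \<in> monoid_gen S" for a
      using that
    proof induction
      case (gen s)
      show ?case
      proof
        fix m assume "m \<in> carrier (M C)"
        with gen have "(s, m, act (M C) s m) \<in> {(s, m, act (M D) s m) | s m. s \<in> S \<and> m \<in> carrier (M D)}"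
          by (subst acts[symmetric]) auto
        then show "act (M C) s m = act (M D) s m" by auto
      qed
    qed (use car base finite_moduleD[OF M(1)] in auto)
    then have "module_iso (M C) (M D)"
      using car base S(2) by (intro module_iso_same_carrier) auto
    then show "C = D"
      using M class_of_cong by metis
  qed
  moreover have "g ` {C. class_dim C \<le> n} \<subseteq> Pow {0..n} \<times> {0..n} \<times> Pow (S \<times> {0..n} \<times> {0..n})"
  proof
    fix x assume "x \<in> g ` {C. class_dim C \<le> n}"
    then obtain C where C: "class_dim C \<le> n" "x = g C" by auto
    then have "carrier (M C) \<subseteq> {0..n}" using M(3)[of C] by auto
    then show "x \<in> Pow {0..n} \<times> {0..n} \<times> Pow (S \<times> {0..n} \<times> {0..n})"
      using C(2) finite_moduleD(2,3)[OF M(1)[of C]] unfolding g_def by blast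
  qed
  ultimately show ?thesis
    using S(1) by (meson finite_Pow_iff finite_SigmaI finite_atLeastAtMost inj_on_finite)
qed

section \<open>Convolution inverses and the antipode\<close>

lemma poly_mapping_expand:
  fixes f :: "'b \<Rightarrow>\<^sub>0 'k::field"
  assumes "finite X" "Poly_Mapping.keys f \<subseteq> X"
  shows "f = (\<Sum>x\<in>X. pm_scale (Poly_Mapping.lookup f x) (Poly_Mapping.single x 1))"
proof (rule poly_mapping_eqI)
  fix k
  have "(\<Sum>x\<in>X. Poly_Mapping.lookup f x * (1 when x = k)) =
      (\<Sum>x\<in>X. if x = k then Poly_Mapping.lookup f x else 0)"
    by (intro sum.cong) auto
  also have "\<dots> = Poly_Mapping.lookup f k"
    using assms by (auto simp: in_keys_iff)
  finally show "Poly_Mapping.lookup f k =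
      Poly_Mapping.lookup (\<Sum>x\<in>X. pm_scale (Poly_Mapping.lookup f x) (Poly_Mapping.single x 1)) k"
    by (simp add: lookup_sum lookup_pm_scale lookup_single)
qed

lemma subspace_keys_subset: "pm_subspace {f :: 'b \<Rightarrow>\<^sub>0 'k::field. Poly_Mapping.keys f \<subseteq> B}"
proof (rule pm.subspaceI)
  fix f g :: "'b \<Rightarrow>\<^sub>0 'k"
  assume "f \<in> {f. Poly_Mapping.keys f \<subseteq> B}" "g \<in> {f. Poly_Mapping.keys f \<subseteq> B}"
  then show "f + g \<in> {f. Poly_Mapping.keys f \<subseteq> B}"
    using keys_add[of f g] by auto
qed (auto simp: in_keys_iff lookup_pm_scale)

lemma span_singles:
  fixes B :: "'b set"
  shows "pm_span ((\<lambda>x. Poly_Mapping.single x (1::'k::field)) ` B) = {f. Poly_Mapping.keys f \<subseteq> B}"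
proof
  show "pm_span ((\<lambda>x. Poly_Mapping.single x (1::'k)) ` B) \<subseteq> {f. Poly_Mapping.keys f \<subseteq> B}"
    by (intro pm.span_minimal subspace_keys_subset) auto
  show "{f. Poly_Mapping.keys f \<subseteq> B} \<subseteq> pm_span ((\<lambda>x. Poly_Mapping.single x (1::'k)) ` B)"
  proof
    fix f :: "'b \<Rightarrow>\<^sub>0 'k" assume "f \<in> {f. Poly_Mapping.keys f \<subseteq> B}"
    then have "(\<Sum>x\<in>Poly_Mapping.keys f. pm_scale (Poly_Mapping.lookup f x) (Poly_Mapping.single x 1)) \<in>
        pm_span ((\<lambda>x. Poly_Mapping.single x (1::'k)) ` B)"
      by (intro pm.span_sum pm.span_scale pm.span_base) auto
    then show "f \<in> pm_span ((\<lambda>x. Poly_Mapping.single x (1::'k)) ` B)"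
      by (subst poly_mapping_expand[of "Poly_Mapping.keys f"]) auto
  qed
qed

lemma tensor_single:
  "tensor (Poly_Mapping.single x (1::'k::field)) (Poly_Mapping.single y 1) = Poly_Mapping.single (x, y) 1"
proof -
  have "(\<lambda>(u, v). Poly_Mapping.lookup (Poly_Mapping.single x (1::'k)) u *
      Poly_Mapping.lookup (Poly_Mapping.single y 1) v) = Poly_Mapping.lookup (Poly_Mapping.single (x, y) 1)"
    by (auto simp: fun_eq_iff lookup_single when_def)
  then show ?thesis
    by (simp add: tensor_def)
qed

text \<open>The coproduct is dual to a monoid structure on the basis: a basis vector
  \<open>z\<close> goes to the sum of all x \<otimes> y with \<open>add x y = z\<close>. So
  \<open>add_assoc\<close> expresses coassociativity, the unit laws make evaluation at
  \<open>e\<close> the counit, and \<open>deg\<close> makes the structure graded and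
  connected.\<close>

locale connected_bialgebra_data =
  fixes mult :: "('b \<Rightarrow>\<^sub>0 'k::field) \<Rightarrow> ('b \<Rightarrow>\<^sub>0 'k) \<Rightarrow> ('b \<Rightarrow>\<^sub>0 'k)"
    and comult :: "('b \<Rightarrow>\<^sub>0 'k) \<Rightarrow> ('b \<times> 'b \<Rightarrow>\<^sub>0 'k)"
    and add :: "'b \<Rightarrow> 'b \<Rightarrow> 'b" and e :: 'b and deg :: "'b \<Rightarrow> nat"
  assumes mult_add_left: "mult (f + g) h = mult f h + mult g h"
    and mult_add_right: "mult f (g + h) = mult f g + mult f h"
    and mult_assoc: "mult (mult f g) h = mult f (mult g h)"
    and mult_one_left: "mult (Poly_Mapping.single e 1) f = f"
    and mult_one_right: "mult f (Poly_Mapping.single e 1) = f"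
    and lookup_comult: "Poly_Mapping.lookup (comult f) (x, y) = Poly_Mapping.lookup f (add x y)"
    and add_assoc: "add (add x y) z = add x (add y z)"
    and add_unit_left: "add e x = x"
    and add_unit_right: "add x e = x"
    and deg_add: "deg (add x y) = deg x + deg y"
    and deg_eq_0_iff: "deg x = 0 \<longleftrightarrow> x = e"
    and finite_decompositions: "finite {(x, y). add x y = z}"
begin

section \<open>The convolution algebra\<close>

definition dec :: "'b \<Rightarrow> ('b \<times> 'b) set" where
  "dec z = {(x, y). add x y = z}"

lemma finite_dec [simp]: "finite (dec z)"
  using finite_decompositions by (simp add: dec_def)

lemma mem_dec [simp]: "(x, y) \<in> dec z \<longleftrightarrow> add x y = z"
  by (simp add: dec_def)

lemma add_eq_unit_iff: "add x y = e \<longleftrightarrow> x = e \<and> y = e"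
  using deg_add[of x y] deg_eq_0_iff by (metis add_is_0)

lemma dec_e: "dec e = {(e, e)}"
  by (auto simp: add_eq_unit_iff)

lemma mult_0_left [simp]: "mult 0 f = 0"
  using mult_add_left[of 0 0 f] by simp

lemma mult_0_right [simp]: "mult f 0 = 0"
  using mult_add_right[of f 0 0] by simp

lemma mult_sum_left: "mult (\<Sum>i\<in>I. F i) g = (\<Sum>i\<in>I. mult (F i) g)"
  by (induction I rule: infinite_finite_induct) (auto simp: mult_add_left)

lemma mult_sum_right: "mult f (\<Sum>i\<in>I. G i) = (\<Sum>i\<in>I. mult f (G i))"
  by (induction I rule: infinite_finite_induct) (auto simp: mult_add_right)

text \<open>A family of values on the basis stands for a linear map, and this is the convolution
  product of two such maps.\<close>

definition conv :: "('b \<Rightarrow> 'b \<Rightarrow>\<^sub>0 'k) \<Rightarrow> ('b \<Rightarrow> 'b \<Rightarrow>\<^sub>0 'k) \<Rightarrow> 'b \<Rightarrow> 'b \<Rightarrow>\<^sub>0 'k" where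
  "conv F G z = (\<Sum>p\<in>dec z. mult (F (fst p)) (G (snd p)))"

text \<open>The values on the basis of the counit followed by the unit map, which is the neutral
  element of convolution.\<close>

definition conv_one :: "'b \<Rightarrow> 'b \<Rightarrow>\<^sub>0 'k" where
  "conv_one z = (if z = e then Poly_Mapping.single e 1 else 0)"

lemma conv_one_left: "conv conv_one F = F"
proof
  fix z
  have "conv conv_one F z = (\<Sum>p\<in>{(e, z)}. mult (conv_one (fst p)) (F (snd p)))"
    unfolding conv_def
    by (rule sum.mono_neutral_right) (auto simp: add_unit_left conv_one_def)
  then show "conv conv_one F z = F z"
    by (simp add: conv_one_def mult_one_left)
qed

lemma conv_one_right: "conv F conv_one = F"
proof
  fix z
  have "conv F conv_one z = (\<Sum>p\<in>{(z, e)}. mult (F (fst p)) (conv_one (snd p)))"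
    unfolding conv_def
    by (rule sum.mono_neutral_right) (auto simp: add_unit_right conv_one_def)
  then show "conv F conv_one z = F z"
    by (simp add: conv_one_def mult_one_right)
qed

lemma conv_assoc: "conv (conv F G) H = conv F (conv G H)"
proof
  fix z
  have "conv (conv F G) H z = (\<Sum>p\<in>dec z. \<Sum>q\<in>dec (fst p). mult (mult (F (fst q)) (G (snd q))) (H (snd p)))"
    by (simp add: conv_def mult_sum_left)
  also have "\<dots> = (\<Sum>(p, q)\<in>Sigma (dec z) (\<lambda>p. dec (fst p)).
      mult (mult (F (fst q)) (G (snd q))) (H (snd p)))"
    by (rule sum.Sigma) auto
  \<comment> \<open>Both index sets encode the triples \<open>u\<close>, \<open>v\<close>,
    \<open>y\<close> with total \<open>z\<close>, together with the partial sum of the first two or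
    of the last two entries. The witnesses keep the triple and recompute the partial sum.\<close>
  also have "\<dots> = (\<Sum>(p, q)\<in>Sigma (dec z) (\<lambda>p. dec (snd p)).
      mult (F (fst p)) (mult (G (fst q)) (H (snd q))))"
    by (rule sum.reindex_bij_witness[of _
          "\<lambda>((u, w), (v, y)). ((add u v, y), (u, v))" "\<lambda>((w, y), (u, v)). ((u, add v y), (v, y))"])
      (auto simp: mult_assoc add_assoc)
  also have "\<dots> = (\<Sum>p\<in>dec z. \<Sum>q\<in>dec (snd p). mult (F (fst p)) (mult (G (fst q)) (H (snd q))))"
    by (rule sum.Sigma[symmetric]) auto
  also have "\<dots> = conv F (conv G H) z"
    by (simp add: conv_def mult_sum_right)
  finally show "conv (conv F G) H z = conv F (conv G H) z" .
qed

text \<open>A second entry other than \<open>e\<close> has positive degree. This drives the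
  termination of \<open>left_inverse\<close> and the induction over it.\<close>

lemma deg_fst_less:
  assumes "p \<in> dec z - {(z, e)}"
  shows "deg (fst p) < deg z"
proof -
  have z: "add (fst p) (snd p) = z" and "p \<noteq> (z, e)"
    using assms by (cases p; simp)+
  then have "snd p \<noteq> e"
    using add_unit_right[of "fst p"] by (metis prod.collapse)
  then show ?thesis
    using deg_add[of "fst p" "snd p"] deg_eq_0_iff[of "snd p"] z by simp
qed

text \<open>Solves \<open>conv G F z = conv_one z\<close> for \<open>G z\<close>: the omitted pair
  \<open>(z, e)\<close> contributes \<open>mult (G z) (F e)\<close>, which is \<open>G z\<close> if
  \<open>F e\<close> is the unit, and the other pairs involve \<open>G\<close> only in smaller
  degree.\<close>

function left_inverse :: "('b \<Rightarrow> 'b \<Rightarrow>\<^sub>0 'k) \<Rightarrow> 'b \<Rightarrow> 'b \<Rightarrow>\<^sub>0 'k" where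
  "left_inverse F z = conv_one z - (\<Sum>p\<in>dec z - {(z, e)}. mult (left_inverse F (fst p)) (F (snd p)))"
  by pat_completeness auto
termination
  by (relation "measure (\<lambda>(F, z). deg z)") (use deg_fst_less in auto)

declare left_inverse.simps [simp del]

lemma conv_left_inverse:
  assumes "F e = Poly_Mapping.single e 1"
  shows "conv (left_inverse F) F = conv_one"
proof
  fix z
  have "conv (left_inverse F) F z = mult (left_inverse F z) (F e) +
      (\<Sum>p\<in>dec z - {(z, e)}. mult (left_inverse F (fst p)) (F (snd p)))"
    unfolding conv_def by (subst sum.remove[of _ "(z, e)"]) (auto simp: add_unit_right)
  then show "conv (left_inverse F) F z = conv_one z"
    using left_inverse.simps[of F z] by (simp add: assms mult_one_right)
qed

text \<open>At \<open>e\<close> the sum is empty, whatever \<open>F\<close> is. So the inverse has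
  value \<open>1\<close> there and can be inverted in turn.\<close>

lemma left_inverse_unit: "left_inverse F e = Poly_Mapping.single e 1"
  by (subst left_inverse.simps) (simp add: dec_e conv_one_def)

text \<open>With G the left inverse of F and H that of G, associativity gives H = H (G F) = (H G) F
  = F, so F G = H G is the neutral element.\<close>

lemma conv_right_inverse:
  assumes "F e = Poly_Mapping.single e 1"
  shows "conv F (left_inverse F) = conv_one"
proof -
  let ?G = "left_inverse F"
  let ?H = "left_inverse ?G"
  have "?H = conv (conv ?H ?G) F"
    using conv_left_inverse[of F, OF assms] by (simp add: conv_assoc conv_one_right)
  then have "?H = F"
    using conv_left_inverse[of ?G, OF left_inverse_unit] by (simp add: conv_one_left)
  then show ?thesis
    using conv_left_inverse[of ?G, OF left_inverse_unit] by simp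
qed

text \<open>On \<open>B\<close> the term \<open>conv_one z\<close> vanishes, since \<open>e\<close>
  is outside \<open>B\<close>. In every summand one of the two parts of \<open>z\<close> lies in
  \<open>B\<close>: the second part puts a value of \<open>F\<close> into \<open>J\<close>, the
  first a value of the inverse, by induction on the degree.\<close>

lemma left_inverse_mem_ideal:
  assumes J: "pm_subspace J" "\<And>f g. f \<in> J \<Longrightarrow> mult f g \<in> J" "\<And>f g. g \<in> J \<Longrightarrow> mult f g \<in> J"
    and B: "\<And>x y. add x y \<in> B \<Longrightarrow> x \<in> B \<or> y \<in> B" "e \<notin> B" "\<And>x. x \<in> B \<Longrightarrow> F x \<in> J"
  shows "z \<in> B \<Longrightarrow> left_inverse F z \<in> J"
proof (induction "deg z" arbitrary: z rule: less_induct)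
  case less
  have "mult (left_inverse F (fst p)) (F (snd p)) \<in> J" if p: "p \<in> dec z - {(z, e)}" for p
  proof -
    have "add (fst p) (snd p) = z"
      using p by (cases p) auto
    then have "fst p \<in> B \<or> snd p \<in> B"
      using B(1) less.prems by blast
    then show ?thesis
      using less.hyps deg_fst_less[OF p] J(2,3) B(3) by blast
  qed
  moreover have "conv_one z = 0"
    using B(2) less.prems by (auto simp: conv_one_def)
  ultimately show ?case
    using pm.subspace_neg[OF J(1) pm.subspace_sum[OF J(1)], of "dec z - {(z, e)}"]
    by (subst left_inverse.simps) (simp only: diff_0)
qed

section \<open>Linear extension and the antipode\<close>

definition extend :: "('b \<Rightarrow> 'b \<Rightarrow>\<^sub>0 'k) \<Rightarrow> ('b \<Rightarrow>\<^sub>0 'k) \<Rightarrow> ('b \<Rightarrow>\<^sub>0 'k)" where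
  "extend F f = (\<Sum>x\<in>Poly_Mapping.keys f. pm_scale (Poly_Mapping.lookup f x) (F x))"

lemma extend_superset:
  assumes "finite X" "Poly_Mapping.keys f \<subseteq> X"
  shows "extend F f = (\<Sum>x\<in>X. pm_scale (Poly_Mapping.lookup f x) (F x))"
  unfolding extend_def using assms by (intro sum.mono_neutral_left) (auto simp: in_keys_iff)

lemma linear_extend: "Vector_Spaces.linear pm_scale pm_scale (extend F)"
proof -
  have "extend F (f + g) = extend F f + extend F g" for f g
  proof -
    let ?X = "Poly_Mapping.keys f \<union> Poly_Mapping.keys g"
    have "extend F (f + g) = (\<Sum>x\<in>?X. pm_scale (Poly_Mapping.lookup (f + g) x) (F x))"
      using keys_add[of f g] by (intro extend_superset) auto
    also have "\<dots> = extend F f + extend F g"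
      by (simp add: extend_superset[of ?X] lookup_add pm.scale_left_distrib sum.distrib)
    finally show ?thesis .
  qed
  moreover have "extend F (pm_scale c f) = pm_scale c (extend F f)" for c f
  proof -
    have "extend F (pm_scale c f) =
        (\<Sum>x\<in>Poly_Mapping.keys f. pm_scale (Poly_Mapping.lookup (pm_scale c f) x) (F x))"
      by (intro extend_superset) (auto simp: in_keys_iff lookup_pm_scale)
    then show ?thesis
      by (simp add: extend_def lookup_pm_scale pm.scale_sum_right)
  qed
  ultimately show ?thesis
    by (auto simp: Vector_Spaces.linear_iff pm.vector_space_axioms)
qed

lemma extend_single: "extend F (Poly_Mapping.single x 1) = F x"
  by (simp add: extend_def)

text \<open>The support of \<open>comult f\<close> is the disjoint union of the sets
  \<open>dec z\<close> over the support of \<open>f\<close>. This links convolution in the tensor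
  basis to the linear extension of \<open>conv\<close>.\<close>

lemma convolution_eq:
  "convolution mult comult S T f = (\<Sum>z\<in>Poly_Mapping.keys f. pm_scale (Poly_Mapping.lookup f z)
     (conv (\<lambda>x. S (Poly_Mapping.single x 1)) (\<lambda>x. T (Poly_Mapping.single x 1)) z))"
proof -
  let ?c = "\<lambda>p. mult (S (Poly_Mapping.single (fst p) 1)) (T (Poly_Mapping.single (snd p) 1))"
  have keys: "Poly_Mapping.keys (comult f) = (\<Union>z\<in>Poly_Mapping.keys f. dec z)"
    by (auto simp: in_keys_iff lookup_comult)
  have "convolution mult comult S T f =
      (\<Sum>p\<in>(\<Union>z\<in>Poly_Mapping.keys f. dec z). pm_scale (Poly_Mapping.lookup (comult f) p) (?c p))"
    by (simp add: convolution_def keys case_prod_beta)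
  also have "\<dots> = (\<Sum>z\<in>Poly_Mapping.keys f. \<Sum>p\<in>dec z. pm_scale (Poly_Mapping.lookup (comult f) p) (?c p))"
    by (rule sum.UNION_disjoint) auto
  also have "\<dots> = (\<Sum>z\<in>Poly_Mapping.keys f. \<Sum>p\<in>dec z. pm_scale (Poly_Mapping.lookup f z) (?c p))"
    by (intro sum.cong refl) (auto simp: lookup_comult)
  finally show ?thesis
    by (simp add: conv_def pm.scale_sum_right)
qed

lemma sum_scale_conv_one:
  "(\<Sum>z\<in>Poly_Mapping.keys f. pm_scale (Poly_Mapping.lookup f z) (conv_one z)) =
     pm_scale (Poly_Mapping.lookup f e) (Poly_Mapping.single e 1)"
proof -
  have "(\<Sum>z\<in>Poly_Mapping.keys f. pm_scale (Poly_Mapping.lookup f z) (conv_one z)) =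
      (\<Sum>z\<in>insert e (Poly_Mapping.keys f). pm_scale (Poly_Mapping.lookup f z) (conv_one z))"
    by (rule sum.mono_neutral_left) (auto simp: in_keys_iff)
  also have "\<dots> = (\<Sum>z\<in>{e}. pm_scale (Poly_Mapping.lookup f z) (conv_one z))"
    by (rule sum.mono_neutral_right) (auto simp: conv_one_def)
  finally show ?thesis
    by (simp add: conv_one_def)
qed

definition antipode :: "('b \<Rightarrow>\<^sub>0 'k) \<Rightarrow> ('b \<Rightarrow>\<^sub>0 'k)" where
  "antipode = extend (left_inverse (\<lambda>x. Poly_Mapping.single x 1))"

lemma is_antipode_antipode:
  "is_antipode mult (Poly_Mapping.single e 1) comult (\<lambda>f. Poly_Mapping.lookup f e) antipode"
proof -
  let ?I = "\<lambda>x. Poly_Mapping.single x (1::'k)"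
  let ?S = "left_inverse ?I"
  have "conv ?S ?I = conv_one" "conv ?I ?S = conv_one"
    by (rule conv_left_inverse conv_right_inverse, rule refl)+
  then show ?thesis
    unfolding is_antipode_def antipode_def convolution_eq extend_single id_apply
    by (simp only: sum_scale_conv_one linear_extend simp_thms)
qed

text \<open>A pair in the support of \<open>comult f\<close> has its sum in \<open>B\<close>, hence
  an entry in \<open>B\<close>, so its basis tensor is a generator of the span in the coideal
  condition. Stability under the antipode reduces by linearity to basis vectors in
  \<open>B\<close>.\<close>

lemma hopf_ideal_keys_subset:
  assumes left: "\<And>f g. Poly_Mapping.keys g \<subseteq> B \<Longrightarrow> Poly_Mapping.keys (mult f g) \<subseteq> B"
    and right: "\<And>f g. Poly_Mapping.keys f \<subseteq> B \<Longrightarrow> Poly_Mapping.keys (mult f g) \<subseteq> B"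
    and B: "\<And>x y. add x y \<in> B \<Longrightarrow> x \<in> B \<or> y \<in> B" "e \<notin> B"
  shows "hopf_ideal mult (Poly_Mapping.single e 1) comult (\<lambda>f. Poly_Mapping.lookup f e)
    {f. Poly_Mapping.keys f \<subseteq> B}"
proof -
  let ?J = "{f :: 'b \<Rightarrow>\<^sub>0 'k. Poly_Mapping.keys f \<subseteq> B}"
  let ?T = "{tensor g h | g h. g \<in> ?J} \<union> {tensor g h | g h. h \<in> ?J}"
  have "comult f \<in> pm_span ?T" if f: "f \<in> ?J" for f
  proof -
    have "x \<in> B \<or> y \<in> B" if "(x, y) \<in> Poly_Mapping.keys (comult f)" for x y
    proof -
      have "add x y \<in> Poly_Mapping.keys f"
        using that by (simp add: in_keys_iff lookup_comult)
      then have "add x y \<in> B"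
        using f by auto
      then show ?thesis
        by (rule B(1))
    qed
    then have "Poly_Mapping.keys (comult f) \<subseteq> {(x, y). x \<in> B \<or> y \<in> B}"
      by auto
    then have "comult f \<in> pm_span ((\<lambda>p. Poly_Mapping.single p 1) ` {(x, y). x \<in> B \<or> y \<in> B})"
      by (simp add: span_singles)
    also have "\<dots> \<subseteq> pm_span ?T"
    proof (rule pm.span_mono)
      have "Poly_Mapping.single (x, y) (1::'k) \<in> ?T" if "x \<in> B \<or> y \<in> B" for x y
      proof -
        let ?x = "Poly_Mapping.single x (1::'k)" and ?y = "Poly_Mapping.single y (1::'k)"
        from that have "?x \<in> ?J \<or> ?y \<in> ?J"
          by auto
        then have "tensor ?x ?y \<in> ?T"
        proof
          assume "?x \<in> ?J"
          then have "\<exists>g h. tensor ?x ?y = tensor g h \<and> g \<in> ?J"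
            by (intro exI[of _ ?x] exI[of _ ?y] conjI refl)
          then show ?thesis
            by (rule UnI1[OF CollectI])
        next
          assume "?y \<in> ?J"
          then have "\<exists>g h. tensor ?x ?y = tensor g h \<and> h \<in> ?J"
            by (intro exI[of _ ?x] exI[of _ ?y] conjI refl)
          then show ?thesis
            by (rule UnI2[OF CollectI])
        qed
        then show ?thesis
          by (simp only: tensor_single)
      qed
      then show "(\<lambda>p. Poly_Mapping.single p 1) ` {(x, y). x \<in> B \<or> y \<in> B} \<subseteq> ?T"
        by fast
    qed
    finally show ?thesis .
  qed
  moreover have "antipode f \<in> ?J" if "f \<in> ?J" for f
    unfolding antipode_def extend_def
  proof (intro pm.subspace_sum pm.subspace_scale subspace_keys_subset
      left_inverse_mem_ideal[where B = B])
    show "x \<in> B" if "x \<in> Poly_Mapping.keys f" for x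
      using that \<open>f \<in> ?J\<close> by auto
  qed (use left right B in auto)
  ultimately show ?thesis
    unfolding hopf_ideal_def
  proof (intro conjI ballI allI exI[of _ antipode])
    fix f assume "f \<in> ?J"
    then show "Poly_Mapping.lookup f e = 0"
      using B(2) by (auto simp: in_keys_iff)
  qed (use left right is_antipode_antipode subspace_keys_subset in auto)
qed

end

section \<open>Gradings\<close>

lemma admits_gradingE:
  assumes "admits_grading A M"
  obtains D where "\<And>\<gamma>. base M \<in> D \<gamma>" "(\<Union>\<gamma>. D \<gamma>) = carrier M"
    "\<And>\<gamma> \<delta>. \<gamma> \<noteq> \<delta> \<Longrightarrow> D \<gamma> \<inter> D \<delta> = {base M}"
    "\<And>\<gamma> \<delta> a m. a \<in> A \<gamma> \<Longrightarrow> m \<in> D \<delta> \<Longrightarrow> act M a m \<in> D (\<gamma> + \<delta>)"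
proof -
  obtain D where "pointed_decomp (carrier M) (base M) D \<and>
      (\<forall>\<gamma> \<delta>. \<forall>a\<in>A \<gamma>. \<forall>m\<in>D \<delta>. act M a m \<in> D (\<gamma> + \<delta>))"
    using assms unfolding admits_grading_def ..
  then show thesis
    by (intro that[of D]) (auto simp: pointed_decomp_def)
qed

lemma admits_grading_iso:
  assumes M: "finite_module M" and "module_iso M M'" and "admits_grading A M"
  shows "admits_grading A M'"
proof -
  obtain h where h: "bij_betw h (carrier M) (carrier M')" "h (base M) = base M'"
    "\<And>a m. m \<in> carrier M \<Longrightarrow> h (act M a m) = act M' a (h m)"
    using assms(2) by (auto simp: module_iso_def)
  obtain D where D: "\<And>\<gamma>. base M \<in> D \<gamma>" "(\<Union>\<gamma>. D \<gamma>) = carrier M"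
    "\<And>\<gamma> \<delta>. \<gamma> \<noteq> \<delta> \<Longrightarrow> D \<gamma> \<inter> D \<delta> = {base M}"
    "\<And>\<gamma> \<delta> a m. a \<in> A \<gamma> \<Longrightarrow> m \<in> D \<delta> \<Longrightarrow> act M a m \<in> D (\<gamma> + \<delta>)"
    using admits_gradingE[OF assms(3)] by metis
  have sub: "D \<gamma> \<subseteq> carrier M" for \<gamma>
    using D(2) by auto
  have inj: "inj_on h (carrier M)" and im: "h ` carrier M = carrier M'"
    using h(1) by (auto simp: bij_betw_def)
  show ?thesis
    unfolding admits_grading_def pointed_decomp_def
  proof (intro exI[of _ "\<lambda>\<gamma>. h ` D \<gamma>"] conjI allI ballI impI)
    show "base M' \<in> h ` D \<gamma>" for \<gamma>
      using D(1) h(2) by (metis imageI)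
    show "(\<Union>\<gamma>. h ` D \<gamma>) = carrier M'"
      using D(2) im by (simp flip: image_UN)
    show "h ` D \<gamma> \<inter> h ` D \<delta> = {base M'}" if "\<gamma> \<noteq> \<delta>" for \<gamma> \<delta>
      using inj_on_image_Int[OF inj sub sub] D(3)[OF that] h(2) by (metis image_empty image_insert)
    show "act M' a m \<in> h ` D (\<gamma> + \<delta>)" if a: "a \<in> A \<gamma>" and "m \<in> h ` D \<delta>" for \<gamma> \<delta> a m
    proof -
      obtain x where x: "x \<in> D \<delta>" "m = h x"
        using \<open>m \<in> h ` D \<delta>\<close> by auto
      then have "act M' a m = h (act M a x)"
        using h(3)[of x a] sub[of \<delta>] by auto
      then show ?thesis
        using D(4)[OF a x(1)] by simp
    qed
  qed
qed

lemma admits_grading_rep_class_of: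
  assumes "finite_module M"
  shows "admits_grading A (rep (class_of M)) \<longleftrightarrow> admits_grading A M"
  using assms admits_grading_iso finite_module_rep rep_class_of_iso module_iso_sym by metis

lemma admits_grading_restrict:
  assumes N: "submodule N M" and "admits_grading A M"
  shows "admits_grading A (restrict_module M N)"
proof -
  obtain D where D: "\<And>\<gamma>. base M \<in> D \<gamma>" "(\<Union>\<gamma>. D \<gamma>) = carrier M"
    "\<And>\<gamma> \<delta>. \<gamma> \<noteq> \<delta> \<Longrightarrow> D \<gamma> \<inter> D \<delta> = {base M}"
    "\<And>\<gamma> \<delta> a m. a \<in> A \<gamma> \<Longrightarrow> m \<in> D \<delta> \<Longrightarrow> act M a m \<in> D (\<gamma> + \<delta>)"
    using admits_gradingE[OF assms(2)] by metis
  note N = submoduleD[OF N]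
  show ?thesis
    unfolding admits_grading_def pointed_decomp_def
  proof (intro exI[of _ "\<lambda>\<gamma>. D \<gamma> \<inter> N"] conjI allI ballI impI)
    show "(\<Union>\<gamma>. D \<gamma> \<inter> N) = carrier (restrict_module M N)"
      using D(2) N(1) by auto
    show "D \<gamma> \<inter> N \<inter> (D \<delta> \<inter> N) = {base (restrict_module M N)}" if "\<gamma> \<noteq> \<delta>" for \<gamma> \<delta>
      using D(3)[OF that] N(2) by auto
  qed (use D N in auto)
qed

lemma admits_grading_quotient:
  assumes N: "submodule N M" and "admits_grading A M"
  shows "admits_grading A (quotient_module M N)"
proof -
  obtain D where D: "\<And>\<gamma>. base M \<in> D \<gamma>" "(\<Union>\<gamma>. D \<gamma>) = carrier M"
    "\<And>\<gamma> \<delta>. \<gamma> \<noteq> \<delta> \<Longrightarrow> D \<gamma> \<inter> D \<delta> = {base M}"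
    "\<And>\<gamma> \<delta> a m. a \<in> A \<gamma> \<Longrightarrow> m \<in> D \<delta> \<Longrightarrow> act M a m \<in> D (\<gamma> + \<delta>)"
    using admits_gradingE[OF assms(2)] by metis
  note N = submoduleD[OF N]
  show ?thesis
    unfolding admits_grading_def pointed_decomp_def
  \<comment> \<open>The base point lies in \<open>N\<close>, so removing \<open>N\<close> loses it
    and it is put back into each component.\<close>
  proof (intro exI[of _ "\<lambda>\<gamma>. insert (base M) (D \<gamma> - N)"] conjI allI ballI impI)
    show "(\<Union>\<gamma>. insert (base M) (D \<gamma> - N)) = carrier (quotient_module M N)"
      using D(2) by auto
    show "insert (base M) (D \<gamma> - N) \<inter> insert (base M) (D \<delta> - N) = {base (quotient_module M N)}"
      if "\<gamma> \<noteq> \<delta>" for \<gamma> \<delta>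
      using D(3)[OF that] by auto
    \<comment> \<open>The base point lies in every \<open>D \<delta>\<close>, so \<open>m\<close> is
      in \<open>D \<delta>\<close> in either case; a translate that falls into \<open>N\<close>
      becomes the base point.\<close>
    show "act (quotient_module M N) a m \<in> insert (base M) (D (\<gamma> + \<delta>) - N)"
      if "a \<in> A \<gamma>" "m \<in> insert (base M) (D \<delta> - N)" for \<gamma> \<delta> a m
      using D(1)[of \<delta>] D(4)[OF that(1), of m \<delta>] that(2) by auto
  qed simp
qed

lemma admits_grading_wedge:
  assumes M: "finite_module M" "admits_grading A M" and N: "finite_module N" "admits_grading A N"
  shows "admits_grading A (wedge M N)"
proof -
  obtain D where D: "\<And>\<gamma>. base M \<in> D \<gamma>" "(\<Union>\<gamma>. D \<gamma>) = carrier M"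
    "\<And>\<gamma> \<delta>. \<gamma> \<noteq> \<delta> \<Longrightarrow> D \<gamma> \<inter> D \<delta> = {base M}"
    "\<And>\<gamma> \<delta> a m. a \<in> A \<gamma> \<Longrightarrow> m \<in> D \<delta> \<Longrightarrow> act M a m \<in> D (\<gamma> + \<delta>)"
    using admits_gradingE[OF M(2)] by metis
  obtain E where E: "\<And>\<gamma>. base N \<in> E \<gamma>" "(\<Union>\<gamma>. E \<gamma>) = carrier N"
    "\<And>\<gamma> \<delta>. \<gamma> \<noteq> \<delta> \<Longrightarrow> E \<gamma> \<inter> E \<delta> = {base N}"
    "\<And>\<gamma> \<delta> a m. a \<in> A \<gamma> \<Longrightarrow> m \<in> E \<delta> \<Longrightarrow> act N a m \<in> E (\<gamma> + \<delta>)"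
    using admits_gradingE[OF N(2)] by metis
  show ?thesis
    unfolding admits_grading_def pointed_decomp_def
  proof (intro exI[of _ "\<lambda>\<gamma>. Inl ` D \<gamma> \<union> Inr ` (E \<gamma> - {base N})"] conjI allI ballI impI)
    show "(\<Union>\<gamma>. Inl ` D \<gamma> \<union> Inr ` (E \<gamma> - {base N})) = carrier (wedge M N)"
      unfolding wedge_simps D(2)[symmetric] E(2)[symmetric] by blast
    show "(Inl ` D \<gamma> \<union> Inr ` (E \<gamma> - {base N})) \<inter> (Inl ` D \<delta> \<union> Inr ` (E \<delta> - {base N})) =
        {base (wedge M N)}" if "\<gamma> \<noteq> \<delta>" for \<gamma> \<delta>
      using D(3)[OF that] E(3)[OF that] unfolding wedge_simps by blast
    show "act (wedge M N) a x \<in> Inl ` D (\<gamma> + \<delta>) \<union> Inr ` (E (\<gamma> + \<delta>) - {base N})"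
      if a: "a \<in> A \<gamma>" and x: "x \<in> Inl ` D \<delta> \<union> Inr ` (E \<delta> - {base N})" for \<gamma> \<delta> a x
      using x D(1)[of "\<gamma> + \<delta>"] D(4)[OF a, of _ \<delta>] E(4)[OF a, of _ \<delta>] by (auto split: if_splits)
  qed (use D(1) in simp)
qed

text \<open>Existence of a grading is invariant under isomorphism, so it may be tested on
  \<open>rep C\<close>, and the span becomes a support condition.\<close>

lemma J_gr_eq: "J_gr A = {f. Poly_Mapping.keys f \<subseteq> {C. \<not> admits_grading A (rep C)}}"
proof -
  have "{delta M | M :: ('a, nat) amod. finite_module M \<and> \<not> admits_grading A M} =
      (\<lambda>C. Poly_Mapping.single C 1) ` {C. \<not> admits_grading A (rep C)}" (is "?L = ?R")
  proof
    show "?L \<subseteq> ?R"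
      by (auto simp: delta_def admits_grading_rep_class_of)
    show "?R \<subseteq> ?L"
    proof
      fix x assume "x \<in> ?R"
      then obtain C where "\<not> admits_grading A (rep C)" "x = Poly_Mapping.single C 1"
        by auto
      then show "x \<in> ?L"
        by (intro CollectI exI[of _ "rep C"]) (simp add: delta_def)
    qed
  qed
  then show ?thesis
    unfolding J_gr_def by (simp only: span_singles)
qed

section \<open>The Hall product\<close>

text \<open>The reason why the Hall product adds degrees; it bounds the classes that can occur in a
  product.\<close>

lemma class_dim_quotient_restrict:
  assumes "finite_module M" "submodule N M"
  shows "class_dim (class_of M) =
    class_dim (class_of (quotient_module M N)) + class_dim (class_of (restrict_module M N))"
  using card_quotient_module[OF assms] card_carrier_pos[OF finite_module_quotient[OF assms]]
    card_carrier_pos[OF finite_module_restrict[OF assms]]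
    class_dim_class_of[OF assms(1)] class_dim_class_of[OF finite_module_quotient[OF assms]]
    class_dim_class_of[OF finite_module_restrict[OF assms]]
  by simp

section \<open>Isomorphism and correspondence theorems for quotient modules\<close>

lemma quotient_quotient_iso:
  assumes "base M \<in> L" "L \<subseteq> N" "N \<subseteq> carrier M"
  shows "module_iso (quotient_module (quotient_module M L) (insert (base M) (N - L))) (quotient_module M N)"
  by (rule module_iso_same_carrier) (use assms in auto)

text \<open>The module \<open>N / L\<close> can be formed inside \<open>M / L\<close>, with carrier
  \<open>insert (base M) (N - L)\<close>, or as a quotient of \<open>N\<close>. Carriers, base
  points and actions coincide, so the identity is an isomorphism.\<close>

lemma restrict_quotient_iso:
  assumes "base M \<in> L" "L \<subseteq> N"
  shows "module_iso (restrict_module (quotient_module M L) (insert (base M) (N - L)))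
    (quotient_module (restrict_module M N) L)"
  by (rule module_iso_same_carrier) (use assms in auto)

lemma restrict_restrict: "restrict_module (restrict_module M N) L = restrict_module M L"
  by (simp add: restrict_module_def)

lemma submodule_restrict_iff:
  assumes "submodule N M"
  shows "submodule L (restrict_module M N) \<longleftrightarrow> submodule L M \<and> L \<subseteq> N"
  using assms by (auto simp: submodule_def)

text \<open>With the next two lemmas this is the correspondence theorem: submodules \<open>N\<close>
  of \<open>M\<close> containing \<open>L\<close> match submodules \<open>K\<close> of
  \<open>M / L\<close>, with \<open>K = N / L\<close> and \<open>N = K \<union> L\<close>.\<close>

lemma submodule_quotient_image:
  assumes "submodule N M" "submodule L M" "finite_module M"
  shows "submodule (insert (base M) (N - L)) (quotient_module M L)"
  using assms by (auto simp: submodule_def finite_module_def)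

lemma submodule_quotient_preimage:
  assumes "submodule K (quotient_module M L)" "submodule L M"
  shows "submodule (K \<union> L) M"
  unfolding submodule_def
proof (intro conjI allI ballI)
  show "K \<union> L \<subseteq> carrier M" "base M \<in> K \<union> L"
    using submoduleD(1)[OF assms(1)] submoduleD(1,2)[OF assms(2)] by auto
  fix a m assume "m \<in> K \<union> L"
  then show "act M a m \<in> K \<union> L"
    using submoduleD(3)[OF assms(1), of m a] submoduleD(3)[OF assms(2), of m a]
    by (auto split: if_splits)
qed

lemma submodule_quotient_base:
  assumes "submodule K (quotient_module M L)" "submodule L M"
  shows "insert (base M) ((K \<union> L) - L) = K"
  using submoduleD(1,2)[OF assms(1)] submoduleD(2)[OF assms(2)] by auto

text \<open>Isolates the consequence of finite generation that gives products and coproducts finite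
  support. The parameter \<open>ty\<close> carries the type \<open>'a\<close>.\<close>

locale finitary_monoid =
  fixes ty :: "'a::{monoid_mult,mult_zero} itself"
  assumes finite_dim_le: "finite {C :: 'a iso_class. class_dim C \<le> n}"
begin

lemma lookup_hall_mult_rep:
  fixes f g :: "'a hall"
  shows "Poly_Mapping.lookup (hall_mult f g) C =
    (\<Sum>N | submodule N (rep C).
       Poly_Mapping.lookup f (class_of (quotient_module (rep C) N)) *
       Poly_Mapping.lookup g (class_of (restrict_module (rep C) N)))"
proof -
  let ?F = "\<lambda>C. \<Sum>N | submodule N (rep C).
       Poly_Mapping.lookup f (class_of (quotient_module (rep C) N)) *
       Poly_Mapping.lookup g (class_of (restrict_module (rep C) N))"
  \<comment> \<open>A class in the support is an extension of some \<open>P\<close> in the support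
    of \<open>f\<close> by some \<open>Q\<close> in that of \<open>g\<close>, so its dimension is
    the sum of theirs. With finitely many pairs, the bound on the dimension leaves finitely many
    classes.\<close>
  have "{C. ?F C \<noteq> 0} \<subseteq> (\<Union>P\<in>Poly_Mapping.keys f. \<Union>Q\<in>Poly_Mapping.keys g.
      {C. class_dim C \<le> class_dim P + class_dim Q})"
  proof
    fix C assume "C \<in> {C. ?F C \<noteq> 0}"
    then obtain N where N: "submodule N (rep C)" and nz:
      "Poly_Mapping.lookup f (class_of (quotient_module (rep C) N)) *
       Poly_Mapping.lookup g (class_of (restrict_module (rep C) N)) \<noteq> 0"
      by (auto elim: sum.not_neutral_contains_not_neutral)
    have "class_dim C = class_dim (class_of (quotient_module (rep C) N)) +
        class_dim (class_of (restrict_module (rep C) N))"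
      using class_dim_quotient_restrict[OF finite_module_rep N] by simp
    then show "C \<in> (\<Union>P\<in>Poly_Mapping.keys f. \<Union>Q\<in>Poly_Mapping.keys g.
        {C. class_dim C \<le> class_dim P + class_dim Q})"
      using nz by (intro UN_I[of "class_of (quotient_module (rep C) N)"]
          UN_I[of "class_of (restrict_module (rep C) N)"]) (auto simp: in_keys_iff)
  qed
  then have "finite {C. ?F C \<noteq> 0}"
    by (rule finite_subset) (intro finite_UN_I finite_keys finite_dim_le)
  then show ?thesis
    unfolding hall_mult_def by (simp add: Abs_poly_mapping_inverse)
qed

text \<open>Associativity evaluates products at quotients and submodules, which need not be the
  chosen representatives.\<close>

lemma lookup_hall_mult:
  fixes f g :: "'a hall"
  assumes "finite_module M"
  shows "Poly_Mapping.lookup (hall_mult f g) (class_of M) =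
    (\<Sum>N | submodule N M.
       Poly_Mapping.lookup f (class_of (quotient_module M N)) *
       Poly_Mapping.lookup g (class_of (restrict_module M N)))"
  unfolding lookup_hall_mult_rep
  by (rule sum_submodules_iso) (use assms rep_class_of_iso in auto)

lemma hall_mult_add_left: "hall_mult (f + g) h = hall_mult f h + hall_mult g (h :: 'a hall)"
  by (rule poly_mapping_eqI) (simp add: lookup_hall_mult_rep lookup_add distrib_right sum.distrib)

lemma hall_mult_add_right: "hall_mult f (g + h) = hall_mult f g + hall_mult f (h :: 'a hall)"
  by (rule poly_mapping_eqI) (simp add: lookup_hall_mult_rep lookup_add distrib_left sum.distrib)

lemma lookup_hall_one:
  assumes "finite_module M"
  shows "Poly_Mapping.lookup hall_one (class_of M :: 'a iso_class) = (if carrier M = {base M} then 1 else 0)"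
  using class_of_eq_zero_iff[OF assms] by (auto simp: hall_one_def delta_def lookup_single when_def)

text \<open>A quotient is zero only if the submodule is everything, so a single term
  survives.\<close>

lemma hall_mult_one_left: "hall_mult hall_one f = (f :: 'a hall)"
proof (rule poly_mapping_eqI)
  fix C :: "'a iso_class"
  let ?M = "rep C"
  note M = finite_moduleD[OF finite_module_rep[of C]]
  have sub: "submodule (carrier ?M) ?M"
    using M by (auto simp: submodule_def)
  have "Poly_Mapping.lookup hall_one (class_of (quotient_module ?M N)) = (if N = carrier ?M then 1 else 0)"
    if "submodule N ?M" for N
  proof -
    have "insert (base ?M) (carrier ?M - N) = {base ?M} \<longleftrightarrow> N = carrier ?M"
      using submoduleD(1,2)[OF that] by auto
    then show ?thesis
      using lookup_hall_one[OF finite_module_quotient[OF finite_module_rep that]] by simp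
  qed
  then have "Poly_Mapping.lookup (hall_mult hall_one f) C =
      (\<Sum>N | submodule N ?M. if N = carrier ?M then Poly_Mapping.lookup f (class_of (restrict_module ?M N)) else 0)"
    unfolding lookup_hall_mult_rep by (intro sum.cong) auto
  also have "\<dots> = Poly_Mapping.lookup f (class_of (restrict_module ?M (carrier ?M)))"
    using sub finite_submodules[OF finite_module_rep[of C]] by simp
  also have "restrict_module ?M (carrier ?M) = ?M"
    by (simp add: restrict_module_def)
  finally show "Poly_Mapping.lookup (hall_mult hall_one f) C = Poly_Mapping.lookup f C"
    by simp
qed

lemma hall_mult_one_right: "hall_mult f hall_one = (f :: 'a hall)"
proof (rule poly_mapping_eqI)
  fix C :: "'a iso_class"
  let ?M = "rep C"
  note M = finite_moduleD[OF finite_module_rep[of C]]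
  have sub: "submodule {base ?M} ?M"
    using M by (auto simp: submodule_def)
  have "Poly_Mapping.lookup (hall_mult f hall_one) C =
      (\<Sum>N | submodule N ?M. if N = {base ?M} then Poly_Mapping.lookup f (class_of (quotient_module ?M N)) else 0)"
    unfolding lookup_hall_mult_rep
    by (intro sum.cong) (auto simp: lookup_hall_one finite_module_restrict)
  also have "\<dots> = Poly_Mapping.lookup f (class_of (quotient_module ?M {base ?M}))"
    using sub finite_submodules[OF finite_module_rep[of C]] by simp
  also have "class_of (quotient_module ?M {base ?M}) = class_of ?M"
    by (intro class_of_cong finite_module_quotient sub module_iso_same_carrier) (use M(2) in auto)
  finally show "Poly_Mapping.lookup (hall_mult f hall_one) C = Poly_Mapping.lookup f C"
    by simp
qed

text \<open>Both sides sum f(M/N) g(N/L) h(L) over the flags L \<subseteq> N \<subseteq> M. The left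
  side lists a flag as \<open>L\<close> with a submodule \<open>K\<close> of \<open>M / L\<close>,
  the right side as \<open>N\<close> with a submodule \<open>L\<close> of \<open>N\<close>.\<close>

lemma hall_mult_assoc: "hall_mult (hall_mult f g) h = hall_mult f (hall_mult g (h :: 'a hall))"
proof (rule poly_mapping_eqI)
  fix C :: "'a iso_class"
  let ?M = "rep C"
  let ?f = "\<lambda>M :: ('a, nat) amod. Poly_Mapping.lookup f (class_of M)"
  let ?g = "\<lambda>M :: ('a, nat) amod. Poly_Mapping.lookup g (class_of M)"
  let ?h = "\<lambda>M :: ('a, nat) amod. Poly_Mapping.lookup h (class_of M)"
  let ?sub = "\<lambda>M :: ('a, nat) amod. {N. submodule N M}"
  have M: "finite_module ?M" by simp
  have "Poly_Mapping.lookup (hall_mult (hall_mult f g) h) C =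
      (\<Sum>L\<in>?sub ?M. \<Sum>K\<in>?sub (quotient_module ?M L).
        ?f (quotient_module (quotient_module ?M L) K) * ?g (restrict_module (quotient_module ?M L) K) *
        ?h (restrict_module ?M L))"
    unfolding lookup_hall_mult_rep[of "hall_mult f g"]
    by (intro sum.cong refl) (simp add: lookup_hall_mult finite_module_quotient sum_distrib_right)
  also have "\<dots> = (\<Sum>(L, K)\<in>Sigma (?sub ?M) (\<lambda>L. ?sub (quotient_module ?M L)).
        ?f (quotient_module (quotient_module ?M L) K) * ?g (restrict_module (quotient_module ?M L) K) *
        ?h (restrict_module ?M L))"
    by (rule sum.Sigma) (auto intro: finite_submodules finite_module_quotient finite_module_rep)
  also have "\<dots> = (\<Sum>(N, L)\<in>Sigma (?sub ?M) (\<lambda>N. ?sub (restrict_module ?M N)).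
        ?f (quotient_module ?M N) * (?g (quotient_module (restrict_module ?M N) L) *
        ?h (restrict_module (restrict_module ?M N) L)))"
  \<comment> \<open>The change of variables is the correspondence theorem; the third isomorphism
    theorem and its companion match the arguments of \<open>f\<close> and \<open>g\<close>.\<close>
  proof (rule sum.reindex_bij_witness[of _
        "\<lambda>(N, L). (L, insert (base ?M) (N - L))" "\<lambda>(L, K). (K \<union> L, L)"])
    fix p assume "p \<in> Sigma (?sub ?M) (\<lambda>L. ?sub (quotient_module ?M L))"
    then obtain L K where p: "p = (L, K)" and L: "submodule L ?M" and K: "submodule K (quotient_module ?M L)"
      by auto
    let ?N = "K \<union> L"
    have N: "submodule ?N ?M"
      using submodule_quotient_preimage[OF K L] .
    have LN: "submodule L (restrict_module ?M ?N)"
      using L submodule_restrict_iff[OF N] by simp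
    have eq: "insert (base ?M) (?N - L) = K"
      using submodule_quotient_base[OF K L] .
    then show "(case (case p of (L, K) \<Rightarrow> (K \<union> L, L)) of (N, L) \<Rightarrow> (L, insert (base ?M) (N - L))) = p"
      by (simp add: p)
    show "(case p of (L, K) \<Rightarrow> (K \<union> L, L)) \<in> Sigma (?sub ?M) (\<lambda>N. ?sub (restrict_module ?M N))"
      using N LN by (simp add: p)
    have "class_of (quotient_module (quotient_module ?M L) K) = class_of (quotient_module ?M ?N)"
      using quotient_quotient_iso[of ?M L ?N] submoduleD(1)[OF N] submoduleD(2)[OF L] K L N
      by (intro class_of_cong finite_module_quotient M) (auto simp: eq)
    moreover have "class_of (restrict_module (quotient_module ?M L) K) =
        class_of (quotient_module (restrict_module ?M ?N) L)"
      using restrict_quotient_iso[of ?M L ?N] submoduleD(2)[OF L] K L N LN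
      by (intro class_of_cong finite_module_quotient finite_module_restrict M) (auto simp: eq)
    ultimately show "(case (case p of (L, K) \<Rightarrow> (K \<union> L, L)) of (N, L) \<Rightarrow>
        ?f (quotient_module ?M N) * (?g (quotient_module (restrict_module ?M N) L) *
        ?h (restrict_module (restrict_module ?M N) L))) =
      (case p of (L, K) \<Rightarrow>
        ?f (quotient_module (quotient_module ?M L) K) * ?g (restrict_module (quotient_module ?M L) K) *
        ?h (restrict_module ?M L))"
      by (simp add: p restrict_restrict mult.assoc)
  next
    fix p assume "p \<in> Sigma (?sub ?M) (\<lambda>N. ?sub (restrict_module ?M N))"
    then obtain N L where p: "p = (N, L)" and N: "submodule N ?M" and "submodule L (restrict_module ?M N)"
      by auto
    then have L: "submodule L ?M" "L \<subseteq> N"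
      using submodule_restrict_iff[OF N] by auto
    then show "(case (case p of (N, L) \<Rightarrow> (L, insert (base ?M) (N - L))) of (L, K) \<Rightarrow> (K \<union> L, L)) = p"
      using submoduleD(2)[OF N] by (auto simp: p)
    show "(case p of (N, L) \<Rightarrow> (L, insert (base ?M) (N - L))) \<in>
        Sigma (?sub ?M) (\<lambda>L. ?sub (quotient_module ?M L))"
      using submodule_quotient_image[OF N L(1) M] L by (simp add: p)
  qed
  also have "\<dots> = (\<Sum>N\<in>?sub ?M. \<Sum>L\<in>?sub (restrict_module ?M N).
        ?f (quotient_module ?M N) * (?g (quotient_module (restrict_module ?M N) L) *
        ?h (restrict_module (restrict_module ?M N) L)))"
    by (rule sum.Sigma[symmetric]) (auto intro: finite_submodules finite_module_restrict finite_module_rep)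
  also have "\<dots> = Poly_Mapping.lookup (hall_mult f (hall_mult g h)) C"
    unfolding lookup_hall_mult_rep[of f]
    by (intro sum.cong refl) (simp add: lookup_hall_mult finite_module_restrict sum_distrib_left)
  finally show "Poly_Mapping.lookup (hall_mult (hall_mult f g) h) C =
    Poly_Mapping.lookup (hall_mult f (hall_mult g h)) C" .
qed

text \<open>The summands of a wedge have at most its dimension. This also keeps the support of the
  coproduct finite.\<close>

lemma finite_class_decompositions: "finite {(P, Q). class_add P Q = (C :: 'a iso_class)}"
proof (rule finite_subset)
  show "{(P, Q). class_add P Q = C} \<subseteq> {P. class_dim P \<le> class_dim C} \<times> {Q. class_dim Q \<le> class_dim C}"
    by (auto simp: class_dim_add)
qed (intro finite_SigmaI finite_dim_le)

lemma lookup_hall_comult: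
  fixes f :: "'a hall"
  shows "Poly_Mapping.lookup (hall_comult f) (P, Q) = Poly_Mapping.lookup f (class_add P Q)"
proof -
  let ?F = "\<lambda>(P, Q). Poly_Mapping.lookup f (class_of (wedge (rep P) (rep Q)))"
  have "{p. ?F p \<noteq> 0} \<subseteq> (\<Union>C\<in>Poly_Mapping.keys f. {(P, Q). class_add P Q = C})"
    by (auto simp: class_add_def in_keys_iff)
  then have "finite {p. ?F p \<noteq> 0}"
    by (rule finite_subset) (intro finite_UN_I finite_keys finite_class_decompositions)
  then show ?thesis
    unfolding hall_comult_def by (simp add: Abs_poly_mapping_inverse class_add_def)
qed

lemma connected_bialgebra_data_hall:
  "connected_bialgebra_data hall_mult hall_comult class_add (class_of zero_module :: 'a iso_class) class_dim"
proof
  show "hall_mult (Poly_Mapping.single (class_of zero_module) 1) f = f" for f :: "'a hall"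
    using hall_mult_one_left by (simp add: hall_one_def delta_def)
  show "hall_mult f (Poly_Mapping.single (class_of zero_module) 1) = f" for f :: "'a hall"
    using hall_mult_one_right by (simp add: hall_one_def delta_def)
qed (fact hall_mult_add_left hall_mult_add_right hall_mult_assoc lookup_hall_comult class_add_assoc
    class_add_zero_left class_add_zero_right class_dim_add class_dim_eq_0_iff finite_class_decompositions)+

text \<open>A nonzero coefficient needs a nonzero term; the absorption arguments on both sides start
  from the resulting submodule.\<close>

lemma hall_mult_key_submodule:
  fixes f g :: "'a hall"
  assumes "C \<in> Poly_Mapping.keys (hall_mult f g)"
  obtains N where "submodule N (rep C)"
    "class_of (quotient_module (rep C) N) \<in> Poly_Mapping.keys f"
    "class_of (restrict_module (rep C) N) \<in> Poly_Mapping.keys g"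
proof -
  have "(\<Sum>N | submodule N (rep C).
       Poly_Mapping.lookup f (class_of (quotient_module (rep C) N)) *
       Poly_Mapping.lookup g (class_of (restrict_module (rep C) N))) \<noteq> 0"
    using assms by (simp add: in_keys_iff lookup_hall_mult_rep)
  then obtain N where "submodule N (rep C)"
    "Poly_Mapping.lookup f (class_of (quotient_module (rep C) N)) *
     Poly_Mapping.lookup g (class_of (restrict_module (rep C) N)) \<noteq> 0"
    by (auto elim: sum.not_neutral_contains_not_neutral)
  then show thesis
    by (intro that[of N]) (auto simp: in_keys_iff)
qed

text \<open>The right factor of a product is evaluated on submodules and the left factor on
  quotients. So left absorption uses that gradings restrict to submodules, right absorption that
  they descend to quotients, and the condition on \<open>class_add\<close> that they combine on
  wedges.\<close>

lemma hopf_ideal_J_gr: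
  fixes A :: "'g::comm_monoid_add \<Rightarrow> 'a set"
  shows "hopf_ideal hall_mult hall_one hall_comult hall_counit (J_gr A)"
proof -
  interpret connected_bialgebra_data hall_mult hall_comult class_add "class_of zero_module :: 'a iso_class" class_dim
    by (rule connected_bialgebra_data_hall)
  let ?B = "{C :: 'a iso_class. \<not> admits_grading A (rep C)}"
  have "hopf_ideal hall_mult (Poly_Mapping.single (class_of zero_module) 1) hall_comult
      (\<lambda>f. Poly_Mapping.lookup f (class_of zero_module)) {f. Poly_Mapping.keys f \<subseteq> ?B}"
  proof (rule hopf_ideal_keys_subset)
    fix f g :: "'a hall" assume g: "Poly_Mapping.keys g \<subseteq> ?B"
    show "Poly_Mapping.keys (hall_mult f g) \<subseteq> ?B"
    proof
      fix C assume "C \<in> Poly_Mapping.keys (hall_mult f g)"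
      then obtain N where N: "submodule N (rep C)"
        and "class_of (restrict_module (rep C) N) \<in> Poly_Mapping.keys g"
        by (rule hall_mult_key_submodule)
      then have "\<not> admits_grading A (restrict_module (rep C) N)"
        using g admits_grading_rep_class_of[OF finite_module_restrict[OF finite_module_rep N]] by auto
      then show "C \<in> ?B"
        using admits_grading_restrict[OF N] by auto
    qed
  next
    fix f g :: "'a hall" assume f: "Poly_Mapping.keys f \<subseteq> ?B"
    show "Poly_Mapping.keys (hall_mult f g) \<subseteq> ?B"
    proof
      fix C assume "C \<in> Poly_Mapping.keys (hall_mult f g)"
      then obtain N where N: "submodule N (rep C)"
        and "class_of (quotient_module (rep C) N) \<in> Poly_Mapping.keys f"
        by (rule hall_mult_key_submodule)
      then have "\<not> admits_grading A (quotient_module (rep C) N)"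
        using f admits_grading_rep_class_of[OF finite_module_quotient[OF finite_module_rep N]] by auto
      then show "C \<in> ?B"
        using admits_grading_quotient[OF N] by auto
    qed
  next
    fix P Q :: "'a iso_class" assume "class_add P Q \<in> ?B"
    then have "\<not> admits_grading A (wedge (rep P) (rep Q))"
      by (simp add: class_add_def admits_grading_rep_class_of finite_module_wedge)
    then show "P \<in> ?B \<or> Q \<in> ?B"
      using admits_grading_wedge[OF finite_module_rep _ finite_module_rep] by blast
  next
    \<comment> \<open>All components may equal \<open>{0}\<close>, since distinct components share
      the base point anyway.\<close>
    have "admits_grading A (zero_module :: ('a, nat) amod)"
      unfolding admits_grading_def pointed_decomp_def by (rule exI[of _ "\<lambda>_. {0}"]) auto
    then show "class_of zero_module \<notin> ?B"
      by (simp add: admits_grading_rep_class_of finite_module_zero)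
  qed
  moreover have "hall_counit = (\<lambda>f :: 'a hall. Poly_Mapping.lookup f (class_of zero_module))"
    by (simp add: fun_eq_iff hall_counit_def)
  ultimately show ?thesis
    unfolding J_gr_eq hall_one_def delta_def by simp
qed

end

theorem theorem4p1p3:
  fixes A :: "'g::comm_monoid_add \<Rightarrow> 'a::{monoid_mult,mult_zero} set"
  assumes "\<exists>S :: 'a set. finite S \<and> monoid_gen S = UNIV"
    and "monoid_grading A"
  shows "hopf_ideal hall_mult hall_one hall_comult hall_counit (J_gr A)"
proof -
  \<comment> \<open>Finite generation is turned into the finiteness assumption of the
    locale.\<close>
  interpret finitary_monoid "TYPE('a)"
    using assms(1) finite_classes_dim_le by unfold_locales blast
  show ?thesis
    by (rule hopf_ideal_J_gr)
qed

end
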